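(* Let $\mathcal{M}\subset\mathbb{R}^d$ be such that there is a compact and convex domain $\mathcal{U}\subset\mathbb{R}^k$ with non-empty interior and a $C^2$ isometry $\phi$ defined on an open set containing $\mathcal{U}$ with $\phi(\mathcal{U})=\mathcal{M}$. Let $\mathbf{X}=\{x_1,\dots,x_n\}\subset\mathcal{M}$ be such that $\max_{x\in\mathcal{M}}\min_i\|x-x_i\|\le\varepsilon$, and let $u_i:=\phi^{-1}(x_i)$. Let $(\hat d_{ij})$ be an estimate of the distances satisfying $$|\mathsf{d}_{\mathcal{M}}(x_i,x_j)-\hat d_{ij}|\le C_0\varepsilon^2\min\{\mathsf{d}_{\mathcal{M}}(x_i,x_j),\hat d_{ij}\},\qquad\forall i,j\in\{1,\dots,n\},$$ where $C_0$ is a constant depending on $\mathcal{M}$. For each set of $k+1$ sample points, embed them in $\mathbb{R}^k$ by Classical Scaling applied to the corresponding $\hat d_{ij}$ and compute the width $\mathrm{width}_2$ of the embedded points. Apply landmark Classical Scaling to $(\hat d_{ij})$ with the $(k+1)$-tuple that gives the largest width as landmarks, and let $\hat u_1,\dots,\hat u_n\in\mathbb{R}^k$ be the resulting embedding. There is a constant $C>0$ depending only on $\mathcal{M}$ (and $C_0$) such that, if $\varepsilon\le1/C$, then $$\min_{Q\in\mathbb{Q}_k}\ \max_{i\in\{1,\dots,n\}}\ \|\hat u_i-Q(u_i)\|\le C\varepsilon^2.$$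
   Context: $\mathsf{d}_{\mathcal{M}}$ is the intrinsic distance on $\mathcal{M}$ (infimum of lengths of curves on $\mathcal{M}$); that $\phi$ is an isometry means in particular $\mathsf{d}_{\mathcal{M}}(\phi(u),\phi(u'))=\|u-u'\|$ for $u,u'\in\mathcal{U}$. $\mathbb{Q}_k$ is the class of rigid transformations of $\mathbb{R}^k$ (orthogonal transformations composed with translations). The $\hat d_{ij}$ are nonnegative and symmetric in $(i,j)$. For points $y_1,\dots,y_m\in\mathbb{R}^k$, let $\mathbf{Y}$ be the $m\times k$ matrix with rows $y_i^\top$; $\mathrm{width}_2(\mathbf{Y})$ is the smallest singular value (the $k$-th largest) of $(2/\sqrt m)\mathbf{Y}$. Classical Scaling with input dissimilarities $(\lambda_{ij})_{i,j\in[m]}$ and dimension $k$: form $B=-\tfrac12 J\Delta J$ with $\Delta=(\lambda_{ij}^2)$, $J=I-\tfrac1m\mathbf{1}\mathbf{1}^\top$; with $\mu_1\ge\dots\ge\mu_m$ the eigenvalues of $B$ and $v_1,\dots,v_m$ corresponding orthonormal eigenvectors, return the rows of the $m\times k$ matrix $[\sqrt{\max(\mu_1,0)}\,v_1,\dots,\sqrt{\max(\mu_k,0)}\,v_k]$ as the embedded points. Gower's lateration with input landmark points $z_1,\dots,z_m\in\mathbb{R}^k$ and dissimilarities $\lambda_1,\dots,\lambda_m$: let $\bar z$ be the barycenter of the $z_i$, $\mathbf{Z}$ the matrix with rows $(z_i-\bar z)^\top$, $\mathbf{Z}^\ddagger$ its Moore–Penrose pseudo-inverse, $\bar a\in\mathbb{R}^m$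 the vector with $j$-th entry $\frac1m\sum_i\|z_i-z_j\|^2$; return $z=\bar z+\tfrac12\mathbf{Z}^\ddagger(\bar a-\ell)$ with $\ell=(\lambda_1^2,\dots,\lambda_m^2)^\top$. Landmark Classical Scaling with a given set of landmark items: embed the landmark items by Classical Scaling, then embed each other item $p$ by Gower's lateration based on the embedded landmarks and the dissimilarities $\hat d_{pi}$ between $p$ and the landmarks $i$. *)

theory Defs
  imports "HOL-Analysis.Analysis"
begin

definition curve_length :: "(real \<Rightarrow> 'a::metric_space) \<Rightarrow> ennreal" where
  "curve_length g =
     (SUP ts \<in> {ts. sorted ts \<and> set ts \<subseteq> {0..1}}.
        \<Sum>i<length ts - 1. ennreal (dist (g (ts ! i)) (g (ts ! Suc i))))"

text \<open>The value is infinite if no curve of finite length in \<open>M\<close> joins the two points.\<close>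

definition intrinsic_dist :: "'a::metric_space set \<Rightarrow> 'a \<Rightarrow> 'a \<Rightarrow> ennreal" where
  "intrinsic_dist M p q =
     (INF g \<in> {g. path g \<and> path_image g \<subseteq> M \<and> pathstart g = p \<and> pathfinish g = q}.
        curve_length g)"

definition C2_on :: "'a::real_normed_vector set \<Rightarrow> ('a \<Rightarrow> 'b::real_normed_vector) \<Rightarrow> bool" where
  "C2_on W f \<longleftrightarrow> open W \<and>
     (\<exists>(D :: 'a \<Rightarrow> 'a \<Rightarrow>\<^sub>L 'b) (D2 :: 'a \<Rightarrow> 'a \<Rightarrow>\<^sub>L ('a \<Rightarrow>\<^sub>L 'b)).
        (\<forall>u\<in>W. (f has_derivative blinfun_apply (D u)) (at u)) \<and>
        (\<forall>u\<in>W. (D has_derivative blinfun_apply (D2 u)) (at u)) \<and>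
        continuous_on W D2)"

text \<open>The isometry property is recorded in its two standard forms: the differential is
  norm-preserving on the open set \<open>W\<close> (Riemannian form), and Euclidean distance on \<open>U\<close> is
  carried to the intrinsic distance on \<open>M\<close> (metric form).\<close>

definition flat_parametrization ::
  "(real ^ 'd) set \<Rightarrow> (real ^ 'k) set \<Rightarrow> (real ^ 'k \<Rightarrow> real ^ 'd) \<Rightarrow> bool" where
  "flat_parametrization M U \<phi> \<longleftrightarrow>
     compact U \<and> convex U \<and> interior U \<noteq> {} \<and> \<phi> ` U = M \<and>
     (\<exists>W. open W \<and> U \<subseteq> W \<and> C2_on W \<phi> \<and>
          (\<forall>u\<in>W. \<forall>v. norm (frechet_derivative \<phi> (at u) v) = norm v)) \<and>
     (\<forall>u\<in>U. \<forall>u'\<in>U. intrinsic_dist M (\<phi> u) (\<phi> u') = ennreal (norm (u - u')))"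

definition rigid_transformations :: "(real ^ 'k \<Rightarrow> real ^ 'k) set" where
  "rigid_transformations = {\<lambda>u. a + T u | a T. orthogonal_transformation T}"

text \<open>An element of \<open>real ^ 'k ^ 'm\<close> is an \<open>m \<times> k\<close> matrix; its rows are \<open>Y $ a\<close>. The set
  below consists of the square roots of the eigenvalues of the \<open>k \<times> k\<close> matrix
  \<open>A\<^sup>T A\<close>. For \<open>m \<ge> k\<close> its minimum is the \<open>k\<close>-th largest singular value.\<close>

definition singular_values :: "real ^ 'k ^ 'm \<Rightarrow> real set" where
  "singular_values A =
     {s. s \<ge> 0 \<and> (\<exists>v. v \<noteq> 0 \<and> (transpose A ** A) *v v = s\<^sup>2 *\<^sub>R v)}"

definition width2 :: "real ^ 'k ^ 'm \<Rightarrow> real" where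
  "width2 Y = Min (singular_values ((2 / sqrt (real CARD('m))) *\<^sub>R Y))"

text \<open>The Moore--Penrose pseudo-inverse is the unique matrix satisfying the four Penrose equations.\<close>

definition pseudo_inverse :: "real ^ 'k ^ 'm \<Rightarrow> real ^ 'm ^ 'k" where
  "pseudo_inverse A =
     (THE P. A ** P ** A = A \<and> P ** A ** P = P \<and>
             transpose (A ** P) = A ** P \<and> transpose (P ** A) = P ** A)"

definition centering_matrix :: "real ^ 'm ^ 'm" where
  "centering_matrix = mat 1 - (\<chi> a b. 1 / real CARD('m))"

text \<open>The output of Classical Scaling depends on the choice of the eigenvectors, hence a relation.
  Eigenvalues are numbered from \<open>0\<close> in decreasing order. The coordinates of \<open>real ^ 'k\<close> are
  indexed by a type without preferred order: \<open>pos c\<close> is the position of coordinate \<open>c\<close>.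
  The dimension \<open>k\<close> is meant to be at most \<open>m\<close>.\<close>

definition classical_scaling :: "real ^ 'm ^ 'm \<Rightarrow> real ^ 'k ^ 'm \<Rightarrow> bool" where
  "classical_scaling \<Lambda> Y \<longleftrightarrow>
     (let \<Delta> = (\<chi> a b. (\<Lambda> $ a $ b)\<^sup>2);
          B = (- (1 / 2)) *\<^sub>R (centering_matrix ** \<Delta> ** centering_matrix)
      in \<exists>(\<mu> :: nat \<Rightarrow> real) (v :: nat \<Rightarrow> real ^ 'm) (pos :: 'k \<Rightarrow> nat).
           (\<forall>i<CARD('m). B *v v i = \<mu> i *\<^sub>R v i) \<and>
           (\<forall>i<CARD('m). \<forall>j<CARD('m). v i \<bullet> v j = (if i = j then 1 else 0)) \<and>
           (\<forall>j<CARD('m). \<forall>i\<le>j. \<mu> j \<le> \<mu> i) \<and>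
           bij_betw pos UNIV {..<CARD('k)} \<and>
           Y = (\<chi> a c. sqrt (max (\<mu> (pos c)) 0) * v (pos c) $ a))"

definition gower_lateration :: "real ^ 'k ^ 'm \<Rightarrow> real ^ 'm \<Rightarrow> real ^ 'k" where
  "gower_lateration z l =
     (let m = real CARD('m);
          zbar = (1 / m) *\<^sub>R (\<Sum>a\<in>UNIV. z $ a);
          Z = (\<chi> a. z $ a - zbar);
          abar = (\<chi> b. (1 / m) * (\<Sum>a\<in>UNIV. (norm (z $ a - z $ b))\<^sup>2))
      in zbar + (1 / 2) *\<^sub>R (pseudo_inverse Z *v (abar - (\<chi> a. (l $ a)\<^sup>2))))"

text \<open>Items are numbered \<open>1, \<dots>, n\<close>. A set of \<open>m\<close> items is given by an injective labelling
  of its elements by the index type \<open>'m\<close>.\<close>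

definition item_tuple :: "nat \<Rightarrow> ('m::finite \<Rightarrow> nat) \<Rightarrow> bool" where
  "item_tuple n l \<longleftrightarrow> inj l \<and> range l \<subseteq> {1..n}"

definition restrict_diss :: "(nat \<Rightarrow> nat \<Rightarrow> real) \<Rightarrow> ('m::finite \<Rightarrow> nat) \<Rightarrow> real ^ 'm ^ 'm" where
  "restrict_diss \<delta> l = (\<chi> a b. \<delta> (l a) (l b))"

definition largest_width_landmarks ::
  "nat \<Rightarrow> (nat \<Rightarrow> nat \<Rightarrow> real) \<Rightarrow> (('m::finite \<Rightarrow> nat) \<Rightarrow> real ^ 'k ^ 'm) \<Rightarrow> ('m \<Rightarrow> nat) \<Rightarrow> bool" where
  "largest_width_landmarks n \<delta> Y l \<longleftrightarrow>
     (\<forall>l'. item_tuple n l' \<longrightarrow> classical_scaling (restrict_diss \<delta> l') (Y l')) \<and>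
     item_tuple n l \<and>
     (\<forall>l'. item_tuple n l' \<longrightarrow> width2 (Y l') \<le> width2 (Y l))"

definition landmark_classical_scaling ::
  "nat \<Rightarrow> (nat \<Rightarrow> nat \<Rightarrow> real) \<Rightarrow> ('m::finite \<Rightarrow> nat) \<Rightarrow> (nat \<Rightarrow> real ^ 'k) \<Rightarrow> bool" where
  "landmark_classical_scaling n \<delta> l uhat \<longleftrightarrow>
     (\<exists>z :: real ^ 'k ^ 'm. classical_scaling (restrict_diss \<delta> l) z \<and>
        (\<forall>a. uhat (l a) = z $ a) \<and>
        (\<forall>p\<in>{1..n} - range l. uhat p = gower_lateration z (\<chi> a. \<delta> p (l a))))"

end

theory Submission
  imports Defs
begin

text \<open>For \<open>k + 1\<close> landmarks, the double-centered matrix \<open>B\<close> annihilates the all-ones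
  vector, so a positive lower bound \<open>c\<close> for its \<open>k\<close>-th eigenvalue is the same as coercivity of
  \<open>B\<close> on the hyperplane of vectors with vanishing sum, and also the same as a lower bound for the
  width of the embedding. A simplex inside \<open>U\<close> is coercive, hence so are sample points close to its
  vertices, and by maximality of the width so are the chosen landmarks.

  Let \<open>z\<close> be the centered embedded landmarks and \<open>Z\<close> the matrix with these rows. The columns of
  \<open>Z\<close> are orthogonal and span the hyperplane, so the centered true landmarks are exactly
  \<open>F z\<close> for a linear map \<open>F\<close>. If the dissimilarities are known up to \<open>\<eta>\<close>, then the vectors
  \<open>F e\<^sub>d\<close> are orthonormal up to \<open>O(\<eta>)\<close>, and Gram--Schmidt replaces \<open>F\<close> by an orthogonal
  map at a cost of \<open>O(\<eta>)\<close>. Lateration is exact for exact data, and \<open>c\<close> bounds the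
  pseudo-inverse, so the other points are recovered up to \<open>O(\<eta>)\<close> as well. Here
  \<open>\<eta> = O(\<epsilon>\<^sup>2)\<close>. All constants depend only on the intrinsic metric of \<open>M\<close>, so they can be read
  off any single parametrization.\<close>

section \<open>Double centering\<close>

text \<open>The bilinear form of the matrix of squared dissimilarities. Error bounds for squared
  dissimilarities carry over to it entry by entry.\<close>

definition quad_form :: "real ^ 'm ^ 'm \<Rightarrow> real ^ 'm \<Rightarrow> real ^ 'm \<Rightarrow> real" where
  "quad_form \<Lambda> p q = (\<Sum>a\<in>UNIV. \<Sum>b\<in>UNIV. p $ a * q $ b * (\<Lambda> $ a $ b)\<^sup>2)"

text \<open>The matrix \<open>B\<close> of \<open>classical_scaling\<close>. For exact Euclidean
  distances it is the Gram matrix of the centered points.\<close>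

definition centered_gram :: "real ^ 'm ^ 'm \<Rightarrow> real ^ 'm ^ 'm" where
  "centered_gram \<Lambda> =
     (- (1 / 2)) *\<^sub>R (centering_matrix ** (\<chi> a b. (\<Lambda> $ a $ b)\<^sup>2) ** centering_matrix)"

lemma transpose_centering_matrix: "transpose centering_matrix = centering_matrix"
  by (simp add: centering_matrix_def transpose_def vec_eq_iff mat_def)

lemma centering_matrix_mult:
  fixes x :: "real ^ 'm"
  shows "centering_matrix *v x = x - (\<chi> a. (\<Sum>b\<in>UNIV. x $ b) / real CARD('m))"
  by (simp add: centering_matrix_def matrix_vector_mult_diff_rdistrib vec_eq_iff)
    (simp add: matrix_vector_mult_def sum_divide_distrib)

text \<open>The centering matrix is symmetric, so its left copy can be moved onto
  \<open>p\<close>.\<close>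

lemma inner_centered_gram:
  fixes p q :: "real ^ 'm"
  shows "p \<bullet> (centered_gram \<Lambda> *v q) =
    - (1 / 2) * quad_form \<Lambda> (centering_matrix *v p) (centering_matrix *v q)"
proof -
  let ?\<Delta> = "\<chi> a b. (\<Lambda> $ a $ b)\<^sup>2"
  have "p \<bullet> (centered_gram \<Lambda> *v q) =
      - (1 / 2) * (p \<bullet> (centering_matrix *v (?\<Delta> *v (centering_matrix *v q))))"
    unfolding centered_gram_def scaleR_matrix_vector_assoc[symmetric] inner_scaleR_right
      matrix_vector_mul_assoc matrix_mul_assoc ..
  also have "p \<bullet> (centering_matrix *v (?\<Delta> *v (centering_matrix *v q))) =
      (centering_matrix *v p) \<bullet> (?\<Delta> *v (centering_matrix *v q))"
    using vector_transpose_matrix[of p centering_matrix]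
    by (simp add: transpose_centering_matrix flip: dot_lmul_matrix)
  also have "x \<bullet> (?\<Delta> *v y) = quad_form \<Lambda> x y" for x y
    unfolding quad_form_def inner_vec_def matrix_vector_mult_def
    by (simp add: sum_distrib_left mult_ac)
  finally show ?thesis .
qed

lemma inner_centered_gram_sum_0:
  fixes p q :: "real ^ 'm"
  assumes "(\<Sum>a\<in>UNIV. p $ a) = 0" "(\<Sum>a\<in>UNIV. q $ a) = 0"
  shows "p \<bullet> (centered_gram \<Lambda> *v q) = - (1 / 2) * quad_form \<Lambda> p q"
  using assms by (simp add: inner_centered_gram centering_matrix_mult zero_vec_def[symmetric])

text \<open>The sum is the inner product with the all-ones vector, and centering maps that vector to
  zero.\<close>

lemma sum_centered_gram_mult:
  fixes q :: "real ^ 'm"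
  shows "(\<Sum>a\<in>UNIV. (centered_gram \<Lambda> *v q) $ a) = 0"
proof -
  have "(\<chi> a. 1) \<bullet> (centered_gram \<Lambda> *v q) = 0"
    unfolding inner_centered_gram by (simp add: centering_matrix_mult quad_form_def)
  then show ?thesis by (simp add: inner_vec_def)
qed

text \<open>When the squared distances are expanded, each squared norm is multiplied by the sum of
  \<open>p\<close> or of \<open>q\<close> and vanishes; only the cross terms survive. This turns
  distances into inner products.\<close>

lemma quad_form_dist:
  fixes u :: "'m::finite \<Rightarrow> 'a::real_inner"
  assumes "(\<Sum>a\<in>UNIV. p $ a) = 0" "(\<Sum>a\<in>UNIV. q $ a) = 0"
  shows "- (1 / 2) * quad_form (\<chi> a b. norm (u a - u b)) p q =
    (\<Sum>a\<in>UNIV. p $ a *\<^sub>R u a) \<bullet> (\<Sum>a\<in>UNIV. q $ a *\<^sub>R u a)"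
proof -
  have "quad_form (\<chi> a b. norm (u a - u b)) p q =
      (\<Sum>a\<in>UNIV. \<Sum>b\<in>UNIV. (p $ a * (norm (u a))\<^sup>2) * q $ b + p $ a * (q $ b * (norm (u b))\<^sup>2)
        - 2 * ((p $ a *\<^sub>R u a) \<bullet> (q $ b *\<^sub>R u b)))"
    unfolding quad_form_def
    by (intro sum.cong refl)
      (simp add: power2_norm_eq_inner inner_diff_left inner_diff_right inner_commute algebra_simps)
  also have "\<dots> = (\<Sum>a\<in>UNIV. p $ a * (norm (u a))\<^sup>2) * (\<Sum>b\<in>UNIV. q $ b)
      + (\<Sum>a\<in>UNIV. p $ a) * (\<Sum>b\<in>UNIV. q $ b * (norm (u b))\<^sup>2)
      - 2 * ((\<Sum>a\<in>UNIV. p $ a *\<^sub>R u a) \<bullet> (\<Sum>a\<in>UNIV. q $ a *\<^sub>R u a))"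
  proof -
    have "(\<Sum>a\<in>UNIV. p $ a *\<^sub>R u a) \<bullet> (\<Sum>a\<in>UNIV. q $ a *\<^sub>R u a) =
        (\<Sum>a\<in>UNIV. \<Sum>b\<in>UNIV. (p $ a *\<^sub>R u a) \<bullet> (q $ b *\<^sub>R u b))"
      unfolding inner_sum_left unfolding inner_sum_right ..
    then show ?thesis
      by (simp only: sum_product sum.distrib sum_subtractf flip: sum_distrib_left)
  qed
  finally show ?thesis using assms by simp
qed

text \<open>Each of the \<open>m * m\<close> terms is estimated separately. The bounds
  \<open>P\<close> and \<open>Q\<close> are kept apart because the form will be applied to two
  columns with different eigenvalues.\<close>

lemma quad_form_perturb:
  fixes \<Lambda> \<Lambda>' :: "real ^ 'm ^ 'm"
  assumes "\<And>a b. \<bar>(\<Lambda> $ a $ b)\<^sup>2 - (\<Lambda>' $ a $ b)\<^sup>2\<bar> \<le> \<eta>"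
    and p: "\<And>a. \<bar>p $ a\<bar> \<le> P" and q: "\<And>a. \<bar>q $ a\<bar> \<le> Q"
  shows "\<bar>quad_form \<Lambda> p q - quad_form \<Lambda>' p q\<bar> \<le> (real CARD('m))\<^sup>2 * (P * Q * \<eta>)"
proof -
  \<comment> \<open>\<open>undefined\<close> merely supplies some index.\<close>
  have P: "0 \<le> P" using p[of undefined] by linarith
  have Q: "0 \<le> Q" using q[of undefined] by linarith
  have "quad_form \<Lambda> p q - quad_form \<Lambda>' p q =
      (\<Sum>a\<in>UNIV. \<Sum>b\<in>UNIV. p $ a * q $ b * ((\<Lambda> $ a $ b)\<^sup>2 - (\<Lambda>' $ a $ b)\<^sup>2))"
    by (simp add: quad_form_def sum_subtractf right_diff_distrib)
  also have "\<bar>\<dots>\<bar> \<le> (\<Sum>a\<in>(UNIV::'m set). \<Sum>b\<in>(UNIV::'m set). P * Q * \<eta>)"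
    by (rule sum_norm_le[where 'a = real, unfolded real_norm_def])+
      (use assms P Q in \<open>auto simp: abs_mult intro!: mult_mono\<close>)
  finally show ?thesis by (simp add: power2_eq_square mult_ac)
qed

section \<open>Spectrum of classical scaling\<close>

text \<open>A lower bound \<open>c\<close> for the spectrum of \<open>B\<close> on the hyperplane of
  centered vectors, phrased without eigenvalues: this form is easy to perturb and does not depend on
  a choice of eigenvectors.\<close>

definition coercive_on_centered :: "real \<Rightarrow> real ^ 'm ^ 'm \<Rightarrow> bool" where
  "coercive_on_centered c \<Lambda> \<longleftrightarrow>
     (\<forall>x. (\<Sum>a\<in>UNIV. x $ a) = 0 \<longrightarrow> c * (norm x)\<^sup>2 \<le> - (1 / 2) * quad_form \<Lambda> x x)"

lemma classical_scalingE:
  fixes Y :: "real ^ 'k ^ 'm"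
  assumes "classical_scaling \<Lambda> Y"
  obtains \<mu> v and pos :: "'k \<Rightarrow> nat"
  where "\<And>i. i < CARD('m) \<Longrightarrow> centered_gram \<Lambda> *v v i = \<mu> i *\<^sub>R v i"
    and "\<And>i j. i < CARD('m) \<Longrightarrow> j < CARD('m) \<Longrightarrow> v i \<bullet> v j = (if i = j then 1 else 0)"
    and "\<And>i j. j < CARD('m) \<Longrightarrow> i \<le> j \<Longrightarrow> \<mu> j \<le> \<mu> i"
    and "bij_betw pos UNIV {..<CARD('k)}"
    and "\<And>a c. Y $ a $ c = sqrt (max (\<mu> (pos c)) 0) * v (pos c) $ a"
proof -
  obtain \<mu> :: "nat \<Rightarrow> real" and v :: "nat \<Rightarrow> real ^ 'm" and pos :: "'k \<Rightarrow> nat"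
    where "\<forall>i<CARD('m). centered_gram \<Lambda> *v v i = \<mu> i *\<^sub>R v i"
      and "\<forall>i<CARD('m). \<forall>j<CARD('m). v i \<bullet> v j = (if i = j then 1 else 0)"
      and "\<forall>j<CARD('m). \<forall>i\<le>j. \<mu> j \<le> \<mu> i" and "bij_betw pos UNIV {..<CARD('k)}"
      and "Y = (\<chi> a c. sqrt (max (\<mu> (pos c)) 0) * v (pos c) $ a)"
    using assms unfolding classical_scaling_def Let_def centered_gram_def by (elim exE conjE)
  then show thesis by (intro that[of v \<mu> pos]) auto
qed

text \<open>The Gram matrix of the columns is diagonal, so the coordinate axes are eigenvectors and
  the singular values are the column norms.\<close>

lemma width2_orthogonal_columns:
  fixes Y :: "real ^ 'k ^ 'm"
  assumes Y: "\<And>c d. (\<Sum>a\<in>UNIV. Y $ a $ c * Y $ a $ d) = (if c = d then (s c)\<^sup>2 else 0)"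
    and s: "\<And>c. 0 \<le> s c"
  shows "width2 Y = 2 / sqrt (real CARD('m)) * Min (range s)"
proof -
  define r where "r = 2 / sqrt (real CARD('m))"
  have r: "r > 0" by (simp add: r_def)
  have mult: "(transpose (r *\<^sub>R Y) ** (r *\<^sub>R Y)) *v v = (\<chi> c. (r * s c)\<^sup>2 * v $ c)" for v
  proof -
    have "(transpose (r *\<^sub>R Y) ** (r *\<^sub>R Y)) $ c $ d = (if c = d then (r * s c)\<^sup>2 else 0)" for c d
      using Y[of c d]
      by (simp add: matrix_matrix_mult_def transpose_def power_mult_distrib mult_ac
          power2_eq_square flip: sum_distrib_left)
    then show ?thesis
      by (simp add: matrix_vector_mult_def if_distrib[of "\<lambda>t. t * _"] cong: if_cong)
  qed
  have "singular_values (r *\<^sub>R Y) = range (\<lambda>c. r * s c)"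
  proof (intro set_eqI iffI)
    fix t assume "t \<in> singular_values (r *\<^sub>R Y)"
    then obtain v where t: "0 \<le> t" and v: "v \<noteq> 0"
      and eq: "(\<chi> c. (r * s c)\<^sup>2 * v $ c) = t\<^sup>2 *\<^sub>R v"
      unfolding singular_values_def mult by blast
    obtain c where "v $ c \<noteq> 0" using v by (auto simp: vec_eq_iff)
    then have "(r * s c)\<^sup>2 = t\<^sup>2"
      using eq by (simp add: vec_eq_iff) (metis mult_right_cancel)
    then have "t = r * s c" using t s[of c] r by (simp add: power2_eq_iff_nonneg)
    then show "t \<in> range (\<lambda>c. r * s c)" by blast
  next
    fix t assume "t \<in> range (\<lambda>c. r * s c)"
    then obtain c where t: "t = r * s c" by blast
    have "(\<chi> d. (r * s d)\<^sup>2 * axis c 1 $ d) = t\<^sup>2 *\<^sub>R axis c (1::real)"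
      by (simp add: vec_eq_iff t axis_def)
    moreover have "axis c (1::real) \<noteq> 0" by (simp add: axis_eq_0_iff)
    ultimately show "t \<in> singular_values (r *\<^sub>R Y)"
      unfolding singular_values_def mult using t s[of c] r
      by (intro CollectI conjI exI[of _ "axis c 1"]) auto
  qed
  then have "width2 Y = Min (range (\<lambda>c. r * s c))"
    by (simp add: width2_def r_def)
  also have "\<dots> = r * Min (range s)"
    using mono_Min_commute[of "(*) r" "range s"] r
    by (simp add: mono_def image_image mult_left_mono)
  finally show ?thesis by (simp add: r_def)
qed

text \<open>As many independent vectors as the dimension span the space, so the family is an
  orthonormal basis.\<close>

lemma orthonormal_family_expansion:
  fixes v :: "nat \<Rightarrow> real ^ 'm"
  assumes orth: "\<And>i j. i < CARD('m) \<Longrightarrow> j < CARD('m) \<Longrightarrow> v i \<bullet> v j = (if i = j then 1 else 0)"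
  shows "(\<Sum>i<CARD('m). (x \<bullet> v i) *\<^sub>R v i) = x"
proof -
  let ?I = "{..<CARD('m)}"
  have inj: "inj_on v ?I"
    by (rule inj_onI) (metis lessThan_iff orth zero_neq_one)
  have "pairwise orthogonal (v ` ?I)"
    by (auto simp: pairwise_def orthogonal_def orth)
  moreover have "0 \<notin> v ` ?I"
    using orth by (metis imageE inner_zero_left lessThan_iff zero_neq_one)
  ultimately have indep: "independent (v ` ?I)" and pw: "pairwise orthogonal (v ` ?I)"
    using pairwise_orthogonal_independent by blast+
  have "UNIV \<subseteq> span (v ` ?I)"
    by (rule card_ge_dim_independent) (use indep inj in \<open>auto simp: card_image\<close>)
  then have x: "x \<in> span (v ` ?I)" by blast
  have "(\<Sum>b\<in>v ` ?I. (x \<bullet> b) *\<^sub>R b) = x"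
    by (intro orthonormal_basis_expand[OF pw _ x]) (auto simp: norm_eq_1 orth)
  then show ?thesis
    by (simp add: sum.reindex[OF inj])
qed

text \<open>The columns are orthonormal eigenvectors scaled by square roots of truncated
  eigenvalues, so the width is determined by the smallest of these.\<close>

lemma classical_scaling_columns:
  fixes v :: "nat \<Rightarrow> real ^ 'm" and Y :: "real ^ 'k ^ 'm"
  assumes "\<And>i j. i < CARD('m) \<Longrightarrow> j < CARD('m) \<Longrightarrow> v i \<bullet> v j = (if i = j then 1 else 0)"
    and pos: "bij_betw pos UNIV {..<CARD('k)}" and k: "CARD('k) \<le> CARD('m)"
    and Y: "\<And>a c. Y $ a $ c = sqrt (max (\<mu> (pos c)) 0) * v (pos c) $ a"
  shows "(\<Sum>a\<in>UNIV. Y $ a $ c * Y $ a $ d) = (if c = d then (sqrt (max (\<mu> (pos c)) 0))\<^sup>2 else 0)"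
    and "width2 Y = 2 / sqrt (real CARD('m)) * Min (range (\<lambda>c. sqrt (max (\<mu> (pos c)) 0)))"
proof -
  have pos_less: "pos c < CARD('m)" for c
    using bij_betwE[OF pos] k by (meson UNIV_I lessThan_iff order_less_le_trans)
  have pos_eq: "pos c = pos d \<longleftrightarrow> c = d" for c d
    using bij_betw_imp_inj_on[OF pos] by (auto dest: injD)
  have cols: "(\<Sum>a\<in>UNIV. Y $ a $ c * Y $ a $ d) = (if c = d then (sqrt (max (\<mu> (pos c)) 0))\<^sup>2 else 0)"
    for c d
  proof -
    have "(\<Sum>a\<in>UNIV. Y $ a $ c * Y $ a $ d) =
        sqrt (max (\<mu> (pos c)) 0) * sqrt (max (\<mu> (pos d)) 0) * (v (pos c) \<bullet> v (pos d))"
      by (simp add: Y inner_vec_def sum_distrib_left mult_ac)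
    then show ?thesis
      by (simp add: assms(1) pos_less pos_eq power2_eq_square)
  qed
  then show "(\<Sum>a\<in>UNIV. Y $ a $ c * Y $ a $ d) =
      (if c = d then (sqrt (max (\<mu> (pos c)) 0))\<^sup>2 else 0)" .
  show "width2 Y = 2 / sqrt (real CARD('m)) * Min (range (\<lambda>c. sqrt (max (\<mu> (pos c)) 0)))"
    by (rule width2_orthogonal_columns[OF cols]) simp
qed

section \<open>The constant eigenvector, and coercivity in terms of width and eigenvalues\<close>

lemma inner_1_vec: "(x :: real ^ 'm) \<bullet> (\<chi> a. 1) = (\<Sum>a\<in>UNIV. x $ a)"
  by (simp add: inner_vec_def)

text \<open>The image of \<open>B\<close> consists of centered vectors, and a nonzero eigenvalue
  puts the eigenvector in that image.\<close>

lemma eigenvector_centered_gram_sum_0: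
  assumes "centered_gram \<Lambda> *v v = \<mu> *\<^sub>R v" "\<mu> \<noteq> 0"
  shows "(\<Sum>a\<in>UNIV. v $ a) = 0"
  using sum_centered_gram_mult[of \<Lambda> v] assms by (simp flip: sum_distrib_left)

text \<open>In the expansion of the all-ones vector every coefficient but the last vanishes, so that
  vector is a multiple of \<open>v n\<close>.\<close>

lemma last_eigenvector_const:
  fixes v :: "nat \<Rightarrow> real ^ 'm"
  assumes orth: "\<And>i j. i < CARD('m) \<Longrightarrow> j < CARD('m) \<Longrightarrow> v i \<bullet> v j = (if i = j then 1 else 0)"
    and m: "CARD('m) = Suc n"
    and v0: "\<And>i. i < n \<Longrightarrow> (\<Sum>a\<in>UNIV. v i $ a) = 0"
  obtains r where "v n = (\<chi> a. r)"
proof -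
  let ?s = "\<Sum>a\<in>UNIV. v n $ a"
  have "(\<chi> a. 1) = (\<Sum>i<CARD('m). ((\<chi> a. 1) \<bullet> v i) *\<^sub>R v i)"
    by (rule orthonormal_family_expansion[OF orth, symmetric])
  also have "\<dots> = ?s *\<^sub>R v n"
    unfolding m using v0 by (simp add: inner_commute[of "\<chi> a. 1"] inner_1_vec)
  finally have eq: "(\<chi> a. 1) = ?s *\<^sub>R v n" .
  then obtain s where s: "(\<chi> a. 1) = s *\<^sub>R v n" by blast
  have "v n $ a = 1 / s" for a
  proof -
    have one: "s * v n $ a = 1" using arg_cong[OF s, of "\<lambda>x. x $ a"] by simp
    then have "s \<noteq> 0" by auto
    with one show ?thesis by (metis nonzero_eq_divide_eq mult.commute)
  qed
  then have "v n = (\<chi> a. 1 / s)" by (simp add: vec_eq_iff)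
  then show thesis by (rule that)
qed

text \<open>A large width forces the first \<open>k\<close> eigenvalues to be at least
  \<open>c > 0\<close>, so their eigenvectors are centered. The one remaining eigenvector is
  constant and hence orthogonal to every centered \<open>x\<close>, which therefore only sees
  eigenvalues at least \<open>c\<close>.\<close>

lemma coercive_of_width2:
  fixes Y :: "real ^ 'k ^ 'm"
  assumes m: "CARD('m) = CARD('k) + 1" and "classical_scaling \<Lambda> Y" and "0 < c"
    and width: "2 / sqrt (real CARD('m)) * sqrt c \<le> width2 Y"
  shows "coercive_on_centered c \<Lambda>"
  unfolding coercive_on_centered_def
proof (intro allI impI)
  fix x :: "real ^ 'm"
  assume x: "(\<Sum>a\<in>UNIV. x $ a) = 0"
  obtain \<mu> v and pos :: "'k \<Rightarrow> nat"
    where eig: "\<And>i. i < CARD('m) \<Longrightarrow> centered_gram \<Lambda> *v v i = \<mu> i *\<^sub>R v i"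
      and orth: "\<And>i j. i < CARD('m) \<Longrightarrow> j < CARD('m) \<Longrightarrow> v i \<bullet> v j = (if i = j then 1 else 0)"
      and pos: "bij_betw pos UNIV {..<CARD('k)}"
      and Y: "\<And>a c. Y $ a $ c = sqrt (max (\<mu> (pos c)) 0) * v (pos c) $ a"
    by (rule classical_scalingE[OF assms(2)],
        rule that) simp_all
  have "width2 Y = 2 / sqrt (real CARD('m)) * Min (range (\<lambda>c. sqrt (max (\<mu> (pos c)) 0)))"
    by (rule classical_scaling_columns[OF orth pos _ Y]) (use m in auto)
  then have "sqrt c \<le> Min (range (\<lambda>c. sqrt (max (\<mu> (pos c)) 0)))"
    using width by (simp add: divide_right_mono field_simps)
  \<comment> \<open>The truncation at zero cannot produce the positive value \<open>c\<close>, so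
    the bound holds for the eigenvalue itself.\<close>
  then have "c \<le> \<mu> (pos d)" for d
    using \<open>0 < c\<close> by (auto simp: le_max_iff_disj)
  then have ge: "c \<le> \<mu> i" if "i < CARD('k)" for i
    using that pos by (metis bij_betw_iff_bijections lessThan_iff)
  have v0: "(\<Sum>a\<in>UNIV. v i $ a) = 0" if "i < CARD('k)" for i
    using that ge[OF that] \<open>0 < c\<close> m by (intro eigenvector_centered_gram_sum_0[OF eig]) auto
  obtain r where "v (CARD('k)) = (\<chi> a. r)"
    using last_eigenvector_const[OF orth, of "CARD('k)"] v0 m by auto
  then have "x \<bullet> v (CARD('k)) = 0"
    using x by (simp add: inner_vec_def flip: sum_distrib_right)
  then have expand: "x = (\<Sum>i<CARD('k). (x \<bullet> v i) *\<^sub>R v i)"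
    using orthonormal_family_expansion[OF orth, of x] by (simp add: m)
  have "centered_gram \<Lambda> *v x = (\<Sum>i<CARD('k). (x \<bullet> v i) *\<^sub>R (centered_gram \<Lambda> *v v i))"
    by (subst expand) (simp add: vec.sum matrix_vector_mult_scaleR
        linear_sum[OF matrix_vector_mul_linear])
  also have "\<dots> = (\<Sum>i<CARD('k). ((x \<bullet> v i) * \<mu> i) *\<^sub>R v i)"
    using eig m by (intro sum.cong) auto
  finally have "x \<bullet> (centered_gram \<Lambda> *v x) = (\<Sum>i<CARD('k). \<mu> i * (x \<bullet> v i)\<^sup>2)"
    by (simp add: inner_sum_right power2_eq_square mult_ac)
  moreover have "(\<Sum>i<CARD('k). c * (x \<bullet> v i)\<^sup>2) \<le> \<dots>"
    using ge by (intro sum_mono mult_right_mono) auto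
  moreover have "(norm x)\<^sup>2 = (\<Sum>i<CARD('k). (x \<bullet> v i)\<^sup>2)"
    using arg_cong[OF expand, of "\<lambda>y. x \<bullet> y"]
    unfolding power2_norm_eq_inner by (simp add: inner_sum_right power2_eq_square)
  ultimately show "c * (norm x)\<^sup>2 \<le> - (1 / 2) * quad_form \<Lambda> x x"
    using inner_centered_gram_sum_0[OF x x, of \<Lambda>] by (simp add: sum_distrib_left)
qed

text \<open>Two orthonormal eigenvectors have a nonzero centered combination.\<close>
lemma coercive_eigenvalue_ge:
  fixes v :: "nat \<Rightarrow> real ^ 'm"
  assumes eig: "\<And>i. i < CARD('m) \<Longrightarrow> centered_gram \<Lambda> *v v i = \<mu> i *\<^sub>R v i"
    and orth: "\<And>i j. i < CARD('m) \<Longrightarrow> j < CARD('m) \<Longrightarrow> v i \<bullet> v j = (if i = j then 1 else 0)"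
    and dec: "\<And>i j. j < CARD('m) \<Longrightarrow> i \<le> j \<Longrightarrow> \<mu> j \<le> \<mu> i"
    and coercive: "coercive_on_centered c \<Lambda>" and ij: "i < j" "j < CARD('m)"
  shows "c \<le> \<mu> i"
proof (rule ccontr)
  assume less: "\<not> c \<le> \<mu> i"
  let ?s = "\<lambda>i. \<Sum>a\<in>UNIV. v i $ a"
  have \<mu>: "\<mu> j \<le> \<mu> i" using dec ij by auto
  \<comment> \<open>The coefficients make the two coordinate sums cancel; if \<open>v j\<close> is
    already centered, it is taken alone.\<close>
  obtain \<alpha> \<beta> where \<alpha>\<beta>: "\<alpha> * ?s i + \<beta> * ?s j = 0" "\<alpha> \<noteq> 0 \<or> \<beta> \<noteq> 0"
  proof (cases "?s j = 0")
    case True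
    then show thesis by (intro that[of 0 1]) auto
  next
    case False
    then show thesis by (intro that[of "?s j" "- ?s i"]) (auto simp: mult.commute)
  qed
  define x where "x = \<alpha> *\<^sub>R v i + \<beta> *\<^sub>R v j"
  have x0: "(\<Sum>a\<in>UNIV. x $ a) = 0"
    using \<alpha>\<beta>(1) by (simp add: x_def sum.distrib sum_distrib_left)
  have norm_x: "(norm x)\<^sup>2 = \<alpha>\<^sup>2 + \<beta>\<^sup>2"
    using orth[of i i] orth[of i j] orth[of j i] orth[of j j] ij
    unfolding x_def power2_norm_eq_inner
    by (simp add: inner_add_left inner_add_right power2_eq_square)
  have "centered_gram \<Lambda> *v x = (\<alpha> * \<mu> i) *\<^sub>R v i + (\<beta> * \<mu> j) *\<^sub>R v j"
    using eig[of i] eig[of j] ij by (simp add: x_def matrix_vector_right_distrib matrix_vector_mult_scaleR)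
  then have "x \<bullet> (centered_gram \<Lambda> *v x) = \<mu> i * \<alpha>\<^sup>2 + \<mu> j * \<beta>\<^sup>2"
    using orth[of i i] orth[of i j] orth[of j i] orth[of j j] ij
    by (simp add: x_def inner_add_left inner_add_right power2_eq_square)
  also have "\<dots> \<le> \<mu> i * \<alpha>\<^sup>2 + \<mu> i * \<beta>\<^sup>2"
    using \<mu> by (intro add_left_mono mult_right_mono) auto
  also have "\<dots> = \<mu> i * (norm x)\<^sup>2"
    by (simp add: norm_x algebra_simps)
  also have "\<dots> < c * (norm x)\<^sup>2"
    using less \<alpha>\<beta>(2) unfolding norm_x
    by (intro mult_strict_right_mono) (auto simp: sum_power2_gt_zero_iff)
  also have "\<dots> \<le> x \<bullet> (centered_gram \<Lambda> *v x)"
    using coercive x0 inner_centered_gram_sum_0[OF x0 x0]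
    unfolding coercive_on_centered_def by metis
  finally show False by simp
qed

text \<open>Under coercivity the retained eigenvalues \<open>lam d\<close> are at least
  \<open>c\<close>, so truncation changes nothing and the columns of \<open>Y\<close> are nonzero
  centered eigenvectors. The fifth fact says that the rescaled columns resolve the identity on the
  centered hyperplane; it is stated for families of vectors so that it applies to whole point
  configurations. The last fact is the counterpart of \<open>coercive_of_width2\<close>.\<close>

lemma classical_scaling_coerciveE:
  fixes Y :: "real ^ 'k ^ 'm"
  assumes m: "CARD('m) = CARD('k) + 1" and scaling: "classical_scaling \<Lambda> Y"
    and coercive: "coercive_on_centered c \<Lambda>" and "0 < c"
  obtains lam :: "'k \<Rightarrow> real" where "\<And>d. c \<le> lam d"
    and "\<And>d. (\<Sum>a\<in>UNIV. Y $ a $ d) = 0"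
    and "\<And>d e. (\<Sum>a\<in>UNIV. Y $ a $ d * Y $ a $ e) = (if d = e then lam d else 0)"
    and "\<And>d e. - (1 / 2) * quad_form \<Lambda> (column d Y) (column e Y) = (if d = e then (lam d)\<^sup>2 else 0)"
    and "\<And>(w :: 'm \<Rightarrow> 'a::real_vector) a. (\<Sum>b\<in>UNIV. w b) = 0 \<Longrightarrow>
      (\<Sum>d\<in>UNIV. (Y $ a $ d / lam d) *\<^sub>R (\<Sum>b\<in>UNIV. Y $ b $ d *\<^sub>R w b)) = w a"
    and "2 / sqrt (real CARD('m)) * sqrt c \<le> width2 Y"
proof -
  obtain \<mu> v and pos :: "'k \<Rightarrow> nat"
    where eig: "\<And>i. i < CARD('m) \<Longrightarrow> centered_gram \<Lambda> *v v i = \<mu> i *\<^sub>R v i"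
      and orth: "\<And>i j. i < CARD('m) \<Longrightarrow> j < CARD('m) \<Longrightarrow> v i \<bullet> v j = (if i = j then 1 else 0)"
      and dec: "\<And>i j. j < CARD('m) \<Longrightarrow> i \<le> j \<Longrightarrow> \<mu> j \<le> \<mu> i"
      and pos: "bij_betw pos UNIV {..<CARD('k)}"
      and Y: "\<And>a c. Y $ a $ c = sqrt (max (\<mu> (pos c)) 0) * v (pos c) $ a"
    by (rule classical_scalingE[OF scaling],
        rule that) simp_all
  have pos_less: "pos d < CARD('k)" for d
    using bij_betwE[OF pos] by auto
  \<comment> \<open>The index \<open>k\<close> is the last one, since \<open>m = k + 1\<close>, and
    serves as the second eigenvector for every \<open>i < k\<close>.\<close>
  have ge: "c \<le> \<mu> i" if "i < CARD('k)" for i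
    using coercive_eigenvalue_ge[OF eig orth dec coercive, of i "CARD('k)"] that m by auto
  define lam where "lam = (\<lambda>d. \<mu> (pos d))"
  have lam: "c \<le> lam d" for d using ge pos_less by (simp add: lam_def)
  have lam_pos: "0 < lam d" for d using lam[of d] \<open>0 < c\<close> by simp
  have Y': "Y $ a $ d = sqrt (lam d) * v (pos d) $ a" for a d
    using lam_pos[of d] by (simp add: Y lam_def max_def)
  have v0: "(\<Sum>a\<in>UNIV. v i $ a) = 0" if "i < CARD('k)" for i
    using that ge[OF that] \<open>0 < c\<close> m by (intro eigenvector_centered_gram_sum_0[OF eig]) auto
  have Y0: "(\<Sum>a\<in>UNIV. Y $ a $ d) = 0" for d
    using v0[OF pos_less] by (simp add: Y' flip: sum_distrib_left)
  have YY: "(\<Sum>a\<in>UNIV. Y $ a $ d * Y $ a $ e) = (if d = e then lam d else 0)" for d e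
    using classical_scaling_columns(1)[OF orth pos _ Y, of d e] m lam_pos[of d]
    by (auto simp: lam_def max_def)
  have "centered_gram \<Lambda> *v column d Y = lam d *\<^sub>R column d Y" for d
  proof -
    have "column d Y = sqrt (lam d) *\<^sub>R v (pos d)"
      by (simp add: column_def vec_eq_iff Y')
    then show ?thesis
      using eig[of "pos d"] pos_less[of d] m by (simp add: matrix_vector_mult_scaleR lam_def)
  qed
  note eig_col = this
  have quad: "- (1 / 2) * quad_form \<Lambda> (column d Y) (column e Y) = (if d = e then (lam d)\<^sup>2 else 0)"
    for d e
  proof -
    have "- (1 / 2) * quad_form \<Lambda> (column d Y) (column e Y) =
        column d Y \<bullet> (centered_gram \<Lambda> *v column e Y)"
      by (rule inner_centered_gram_sum_0[symmetric]) (simp_all add: column_def Y0)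
    also have "\<dots> = lam e * (column d Y \<bullet> column e Y)"
      by (simp add: eig_col)
    also have "column d Y \<bullet> column e Y = (if d = e then lam d else 0)"
      using YY[of d e] by (simp add: column_def inner_vec_def)
    finally show ?thesis by (simp add: power2_eq_square)
  qed
  have expand: "(\<Sum>d\<in>UNIV. (Y $ a $ d / lam d) *\<^sub>R (\<Sum>b\<in>UNIV. Y $ b $ d *\<^sub>R w b)) = w a"
    if w: "(\<Sum>b\<in>UNIV. w b) = 0" for w :: "'m \<Rightarrow> 'a" and a
  proof -
    obtain r where r: "v (CARD('k)) = (\<chi> a. r)"
      using last_eigenvector_const[OF orth, of "CARD('k)"] v0 m by auto
    \<comment> \<open>The kernel is the identity minus the projection onto the constant eigenvector.
      Its constant part \<open>r * r\<close> disappears when summed against a family with sum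
      zero.\<close>
    have delta: "(\<Sum>d\<in>UNIV. Y $ a $ d / lam d * Y $ b $ d) = (if a = b then 1 else 0) - r * r" for b
    proof -
      have "(if a = b then 1 else 0) = (\<Sum>i<CARD('m). (axis b 1 \<bullet> v i) *\<^sub>R v i) $ a"
        by (subst orthonormal_family_expansion[OF orth]) (auto simp: axis_def)
      also have "\<dots> = (\<Sum>i<CARD('k). v i $ b * v i $ a) + r * r"
        by (simp add: m r inner_axis' )
      also have "(\<Sum>i<CARD('k). v i $ b * v i $ a) = (\<Sum>d\<in>UNIV. v (pos d) $ b * v (pos d) $ a)"
        by (rule sum.reindex_bij_betw[OF pos, symmetric])
      also have "\<dots> = (\<Sum>d\<in>UNIV. Y $ a $ d / lam d * Y $ b $ d)"
        proof (intro sum.cong refl)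
        fix d
        have "s * p / l * (s * q) = (s * s) / l * (q * p)" for s p q l :: real by simp
        then have "Y $ a $ d / lam d * Y $ b $ d =
            (sqrt (lam d) * sqrt (lam d)) / lam d * (v (pos d) $ b * v (pos d) $ a)"
          unfolding Y' .
        then show "v (pos d) $ b * v (pos d) $ a = Y $ a $ d / lam d * Y $ b $ d"
          using lam_pos[of d] by simp
      qed
      finally show ?thesis by linarith
    qed
    have "(\<Sum>d\<in>UNIV. (Y $ a $ d / lam d) *\<^sub>R (\<Sum>b\<in>UNIV. Y $ b $ d *\<^sub>R w b)) =
        (\<Sum>b\<in>UNIV. (\<Sum>d\<in>UNIV. Y $ a $ d / lam d * Y $ b $ d) *\<^sub>R w b)"
      by (simp add: scaleR_sum_right scaleR_sum_left) (rule sum.swap)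
    also have "\<dots> = (\<Sum>b\<in>UNIV. (if a = b then 1 else 0) *\<^sub>R w b) - (r * r) *\<^sub>R (\<Sum>b\<in>UNIV. w b)"
      unfolding delta by (simp only: scaleR_diff_left sum_subtractf scaleR_sum_right)
    also have "\<dots> = w a"
    proof -
      have "(\<Sum>b\<in>UNIV. (if a = b then 1 else 0) *\<^sub>R w b) = (\<Sum>b\<in>UNIV. if a = b then w b else 0)"
        by (intro sum.cong) auto
      then show ?thesis using w by simp
    qed
    finally show ?thesis .
  qed
  have "sqrt c \<le> Min (range (\<lambda>d. sqrt (max (\<mu> (pos d)) 0)))"
    using lam by (auto simp: lam_def le_max_iff_disj)
  then have width: "2 / sqrt (real CARD('m)) * sqrt c \<le> width2 Y"
    using classical_scaling_columns(2)[OF orth pos _ Y] m by (simp add: divide_right_mono)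
  show thesis
    by (rule that[OF lam Y0 YY quad _ width]) (rule expand)
qed

section \<open>Almost orthonormal families\<close>

text \<open>Gram--Schmidt, one vector per induction step, with control of the error. The constant
  \<open>K\<close> is chosen before \<open>f\<close> and \<open>\<eta>\<close>, so it depends only
  on the index set and the types.\<close>

lemma near_orthonormal_family:
  assumes "finite I"
  shows "\<exists>K\<ge>1. \<forall>(f :: 'i \<Rightarrow> 'a::real_inner) \<eta>. 0 \<le> \<eta> \<longrightarrow> K * \<eta> \<le> 1 \<longrightarrow>
    (\<forall>i\<in>I. \<forall>j\<in>I. \<bar>f i \<bullet> f j - (if i = j then 1 else 0)\<bar> \<le> \<eta>) \<longrightarrow>
    (\<exists>g. (\<forall>i\<in>I. \<forall>j\<in>I. g i \<bullet> g j = (if i = j then 1 else 0)) \<and>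
         (\<forall>i\<in>I. norm (f i - g i) \<le> K * \<eta>))"
  using assms
proof (induction I rule: finite_induct)
  case empty
  show ?case by (intro exI[of _ 1]) auto
next
  case (insert x F)
  then obtain K where "K \<ge> 1" and IH: "\<forall>(f :: 'i \<Rightarrow> 'a) \<eta>. 0 \<le> \<eta> \<longrightarrow> K * \<eta> \<le> 1 \<longrightarrow>
    (\<forall>i\<in>F. \<forall>j\<in>F. \<bar>f i \<bullet> f j - (if i = j then 1 else 0)\<bar> \<le> \<eta>) \<longrightarrow>
    (\<exists>g. (\<forall>i\<in>F. \<forall>j\<in>F. g i \<bullet> g j = (if i = j then 1 else 0)) \<and>
         (\<forall>i\<in>F. norm (f i - g i) \<le> K * \<eta>))"
    by (elim exE conjE)
  \<comment> \<open>Each of the \<open>card F\<close> projections removed from \<open>f x\<close>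
    has size at most \<open>(1 + 2 * K) * \<eta>\<close>. The extra \<open>1\<close> accounts for
    the deviation of \<open>norm (f x)\<close> from \<open>1\<close>.\<close>
  define L where "L = 1 + real (card F) * (1 + 2 * K)"
  have L: "L \<ge> 1" using \<open>K \<ge> 1\<close> by (simp add: L_def)
  show ?case
  \<comment> \<open>The new vector costs \<open>L\<close> for the projections and \<open>L\<close>
    for the normalization; the old ones cost \<open>K\<close>. Smallness of the sum also gives
    \<open>L * \<eta> \<le> 1 / 2\<close>, which keeps \<open>b\<close> away from zero.\<close>
  proof (intro exI[of _ "2 * L + K"] conjI allI impI)
    show "1 \<le> 2 * L + K" using L \<open>K \<ge> 1\<close> by linarith
  next
    fix f :: "'i \<Rightarrow> 'a" and \<eta> :: real
    assume \<eta>: "0 \<le> \<eta>" "(2 * L + K) * \<eta> \<le> 1"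
      and f: "\<forall>i\<in>insert x F. \<forall>j\<in>insert x F. \<bar>f i \<bullet> f j - (if i = j then 1 else 0)\<bar> \<le> \<eta>"
    have L\<eta>: "0 \<le> L * \<eta>" "0 \<le> K * \<eta>" using L \<open>K \<ge> 1\<close> \<eta>(1) by auto
    have small: "K * \<eta> \<le> 1" "L * \<eta> \<le> 1 / 2"
      using \<eta>(2) L\<eta> by (auto simp: algebra_simps)
    have "\<eta> \<le> 1"
      using small(1) \<open>K \<ge> 1\<close> \<eta>(1) mult_right_mono[of 1 K \<eta>] by linarith
    obtain g where g: "\<forall>i\<in>F. \<forall>j\<in>F. g i \<bullet> g j = (if i = j then 1 else 0)"
      and fg: "\<forall>i\<in>F. norm (f i - g i) \<le> K * \<eta>"
      using IH[rule_format, OF \<eta>(1) small(1), of f] f by auto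
    have fx: "\<bar>(norm (f x))\<^sup>2 - 1\<bar> \<le> \<eta>"
      using f by (simp add: power2_norm_eq_inner)
    then have "(norm (f x))\<^sup>2 \<le> 2\<^sup>2" using \<open>\<eta> \<le> 1\<close> by simp
    then have norm_fx: "norm (f x) \<le> 2" by (rule power2_le_imp_le) simp
    have norm_fx1: "\<bar>norm (f x) - 1\<bar> \<le> \<eta>"
    proof -
      \<comment> \<open>The factor \<open>norm (f x) + 1\<close> is at least \<open>1\<close>, so
        the deviation of the squared norm dominates that of the norm.\<close>
      have "\<bar>norm (f x) - 1\<bar> * 1 \<le> \<bar>norm (f x) - 1\<bar> * (norm (f x) + 1)"
        by (intro mult_left_mono) auto
      also have "\<dots> = \<bar>(norm (f x) - 1) * (norm (f x) + 1)\<bar>"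
        by (simp add: abs_mult)
      also have "\<dots> = \<bar>(norm (f x))\<^sup>2 - 1\<bar>"
        by (simp add: power2_eq_square algebra_simps)
      finally show ?thesis using fx by simp
    qed
    define b where "b = f x - (\<Sum>i\<in>F. (f x \<bullet> g i) *\<^sub>R g i)"
    have inner_fx: "\<bar>f x \<bullet> g i\<bar> \<le> (1 + 2 * K) * \<eta>" if "i \<in> F" for i
    proof -
      have "f x \<bullet> g i = f x \<bullet> f i - f x \<bullet> (f i - g i)" by (simp add: inner_diff_right)
      moreover have "\<bar>f x \<bullet> f i\<bar> \<le> \<eta>"
        using f[rule_format, of x i] that insert.hyps by (auto split: if_splits)
      moreover have "\<bar>f x \<bullet> (f i - g i)\<bar> \<le> 2 * (K * \<eta>)"
        by (rule order_trans[OF Cauchy_Schwarz_ineq2 mult_mono])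
          (use norm_fx fg that in auto)
      ultimately show ?thesis by (simp add: algebra_simps)
    qed
    have "norm (f x - b) \<le> real (card F) * ((1 + 2 * K) * \<eta>)"
      unfolding b_def using inner_fx g
      by (simp, intro sum_norm_bound) (simp add: norm_eq_1[THEN iffD2])
    \<comment> \<open>One \<open>\<eta>\<close> is left over in \<open>L * \<eta>\<close>, to be
      spent on \<open>norm_fx1\<close> in the next step.\<close>
    then have fxb: "norm (f x - b) \<le> L * \<eta> - \<eta>"
      by (simp add: L_def algebra_simps)
    have nb: "\<bar>norm b - 1\<bar> \<le> L * \<eta>"
      using norm_triangle_ineq3[of "f x" b] fxb norm_fx1 by linarith
    then have b: "norm b > 0" using small(2) by linarith
    have "norm (b - b /\<^sub>R norm b) = \<bar>norm b - 1\<bar>"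
    proof -
      have "b - b /\<^sub>R norm b = (1 - inverse (norm b)) *\<^sub>R b" by (simp add: scaleR_diff_left)
      then have "norm (b - b /\<^sub>R norm b) = \<bar>(1 - inverse (norm b)) * norm b\<bar>"
        by (simp add: abs_mult)
      then show ?thesis using b by (simp add: left_diff_distrib)
    qed
    then have near: "norm (f x - b /\<^sub>R norm b) \<le> 2 * (L * \<eta>)"
      using norm_triangle_ineq[of "f x - b" "b - b /\<^sub>R norm b"] fxb nb \<eta>(1) by simp
    have b_orth: "b \<bullet> g j = 0" if "j \<in> F" for j
    proof -
      have "(\<Sum>i\<in>F. (f x \<bullet> g i) * (g i \<bullet> g j)) = (\<Sum>i\<in>F. if i = j then f x \<bullet> g j else 0)"
        using g that by (intro sum.cong) auto
      then show ?thesis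
        using that insert.hyps by (simp add: b_def inner_diff_left inner_sum_left)
    qed
    define g' where "g' = g(x := b /\<^sub>R norm b)"
    have b_orth': "g j \<bullet> b = 0" if "j \<in> F" for j
      using b_orth[OF that] by (simp add: inner_commute)
    have b_unit: "(b /\<^sub>R norm b) \<bullet> (b /\<^sub>R norm b) = 1"
      using b by (simp add: dot_square_norm power2_eq_square)
    have "g' i \<bullet> g' j = (if i = j then 1 else 0)" if "i \<in> insert x F" "j \<in> insert x F" for i j
      using that insert.hyps g b_orth b_orth' b_unit
      by (cases "i = x"; cases "j = x") (auto simp: g'_def)
    moreover have "norm (f i - g' i) \<le> (2 * L + K) * \<eta>" if "i \<in> insert x F" for i
    proof (cases "i = x")
      case True
      then show ?thesis using near L\<eta> by (simp add: g'_def distrib_right)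
    next
      case False
      then have "norm (f i - g' i) \<le> K * \<eta>" using that fg by (simp add: g'_def)
      then show ?thesis using L\<eta> by (simp add: distrib_right)
    qed
    ultimately show "\<exists>g. (\<forall>i\<in>insert x F. \<forall>j\<in>insert x F. g i \<bullet> g j = (if i = j then 1 else 0)) \<and>
         (\<forall>i\<in>insert x F. norm (f i - g i) \<le> (2 * L + K) * \<eta>)"
      by (intro exI[of _ g'] conjI ballI)
  qed
qed

section \<open>Lateration\<close>

text \<open>A left inverse \<open>P\<close> with \<open>A ** P\<close> symmetric satisfies all four
  Penrose equations. For uniqueness, both \<open>A ** P\<close> and \<open>A ** Q\<close> are the
  orthogonal projection onto the column space of \<open>A\<close>; cancelling \<open>A\<close> from
  the left by \<open>P\<close> gives \<open>P = Q\<close>.\<close>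

lemma pseudo_inverse_eqI:
  assumes PA: "P ** A = mat 1" and sym: "transpose (A ** P) = A ** P"
  shows "pseudo_inverse A = P"
  unfolding pseudo_inverse_def
proof (rule the_equality)
  show "A ** P ** A = A \<and> P ** A ** P = P \<and>
      transpose (A ** P) = A ** P \<and> transpose (P ** A) = P ** A"
    using sym by (simp add: PA matrix_mul_assoc[symmetric])
next
  fix Q
  assume Q: "A ** Q ** A = A \<and> Q ** A ** Q = Q \<and>
      transpose (A ** Q) = A ** Q \<and> transpose (Q ** A) = Q ** A"
  have "A ** P = (A ** Q) ** (A ** P)"
    using Q by (metis matrix_mul_assoc)
  then have "transpose (A ** P) = transpose (A ** P) ** transpose (A ** Q)"
    by (metis matrix_transpose_mul)
  then have "A ** P = (A ** P) ** (A ** Q)"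
    using Q sym by simp
  also have "\<dots> = A ** Q"
    by (metis PA matrix_mul_assoc matrix_mul_lid)
  finally have "P ** (A ** P) = P ** (A ** Q)" by simp
  then show "Q = P"
    by (simp add: PA matrix_mul_assoc)
qed

text \<open>This is the formula for full column rank, inverse of \<open>transpose A ** A\<close>
  times \<open>transpose A\<close>, with a diagonal matrix to invert.\<close>

lemma pseudo_inverse_orthogonal_columns:
  fixes A :: "real ^ 'k ^ 'm" and lam :: "'k \<Rightarrow> real"
  assumes A: "\<And>d e. (\<Sum>a\<in>UNIV. A $ a $ d * A $ a $ e) = (if d = e then lam d else 0)"
    and lam: "\<And>d. lam d \<noteq> 0"
  shows "pseudo_inverse A = (\<chi> d a. A $ a $ d / lam d)"
proof (rule pseudo_inverse_eqI)
  have "(\<Sum>a\<in>UNIV. A $ a $ d / lam d * A $ a $ e) = (if d = e then 1 else 0)" for d e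
    using A[of d e] lam[of d] lam[of e] by (simp flip: sum_divide_distrib)
  then show "(\<chi> d a. A $ a $ d / lam d) ** A = mat 1"
    by (simp add: matrix_matrix_mult_def mat_def vec_eq_iff)
  show "transpose (A ** (\<chi> d a. A $ a $ d / lam d)) = A ** (\<chi> d a. A $ a $ d / lam d)"
    by (simp add: matrix_matrix_mult_def transpose_def vec_eq_iff mult.commute)
qed

lemma abs_power2_diff_le:
  fixes x y :: real
  assumes "\<bar>x - y\<bar> \<le> e" "\<bar>y\<bar> \<le> r"
  shows "\<bar>x\<^sup>2 - y\<^sup>2\<bar> \<le> e * (2 * r + e)"
proof -
  have "\<bar>x\<^sup>2 - y\<^sup>2\<bar> = \<bar>x - y\<bar> * \<bar>x + y\<bar>"
    by (simp add: power2_eq_square algebra_simps flip: abs_mult)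
  also have "\<dots> \<le> e * (2 * r + e)"
    using assms by (intro mult_mono) auto
  finally show ?thesis .
qed

lemma abs_entry_le_sqrt:
  fixes z :: "real ^ 'k ^ 'm"
  assumes "(\<Sum>a\<in>UNIV. z $ a $ d * z $ a $ d) = t"
  shows "\<bar>z $ a $ d\<bar> \<le> sqrt t"
proof -
  have "(z $ a $ d)\<^sup>2 \<le> (\<Sum>a\<in>UNIV. (z $ a $ d)\<^sup>2)"
    by (rule member_le_sum) auto
  then have "(z $ a $ d)\<^sup>2 \<le> t" using assms by (simp add: power2_eq_square)
  then have "sqrt ((z $ a $ d)\<^sup>2) \<le> sqrt t" by (rule real_sqrt_le_mono)
  then show ?thesis by simp
qed

text \<open>Lateration is exact for exact dissimilarities, and linear in the squared dissimilarities.\<close>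
lemma gower_lateration_near:
  fixes z :: "real ^ 'k ^ 'm" and y :: "real ^ 'k"
  assumes ortho: "\<And>d e. (\<Sum>a\<in>UNIV. z $ a $ d * z $ a $ e) = (if d = e then lam d else 0)"
    and centered: "\<And>d. (\<Sum>a\<in>UNIV. z $ a $ d) = 0"
    and lam: "\<And>d. c \<le> lam d" and "0 < c"
    and near: "\<And>b. \<bar>(norm (y - z $ b))\<^sup>2 - (l $ b)\<^sup>2\<bar> \<le> \<delta>"
  shows "norm (gower_lateration z l - y) \<le> real CARD('k) * (real CARD('m) * \<delta> / (2 * sqrt c))"
proof -
  let ?m = "real CARD('m)"
  have lam_pos: "0 < lam d" for d using lam[of d] \<open>0 < c\<close> by simp
  define abar where "abar = (\<chi> b. (1 / ?m) * (\<Sum>a\<in>UNIV. (norm (z $ a - z $ b))\<^sup>2))"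
  \<comment> \<open>The barycenter of the landmarks is zero, so lateration reduces to half the
    pseudo-inverse of \<open>z\<close> itself.\<close>
  have sum_z: "(\<Sum>a\<in>UNIV. z $ a) = 0"
    by (simp add: vec_eq_iff centered)
  have z_id: "(\<chi> a. z $ a) = z" by (simp add: vec_eq_iff)
  have gower: "gower_lateration z l $ d =
      (\<Sum>b\<in>UNIV. z $ b $ d / lam d * (abar $ b - (l $ b)\<^sup>2)) / 2" for d
    unfolding gower_lateration_def Let_def abar_def[symmetric] sum_z
    using pseudo_inverse_orthogonal_columns[OF ortho] lam_pos
    by (simp add: z_id matrix_vector_mult_def less_imp_neq[THEN not_sym])
  \<comment> \<open>The part of the difference in \<open>abar\<close> that does not depend on
    \<open>b\<close>; the centered columns of \<open>z\<close> annihilate it.\<close>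
  define K where "K = (\<Sum>a\<in>UNIV. (norm (z $ a))\<^sup>2) / ?m - (norm y)\<^sup>2"
  have abar: "abar $ b - (norm (y - z $ b))\<^sup>2 = K + 2 * (y \<bullet> z $ b)" for b
  proof -
    have "(\<Sum>a\<in>UNIV. (norm (z $ a - z $ b))\<^sup>2) =
        (\<Sum>a\<in>UNIV. (norm (z $ a))\<^sup>2) - 2 * ((\<Sum>a\<in>UNIV. z $ a) \<bullet> z $ b) + ?m * (norm (z $ b))\<^sup>2"
      unfolding power2_norm_eq_inner inner_sum_left
      by (simp add: inner_diff_left inner_diff_right inner_commute sum.distrib sum_subtractf
          sum_distrib_left algebra_simps)
    then have "abar $ b = (\<Sum>a\<in>UNIV. (norm (z $ a))\<^sup>2) / ?m + (norm (z $ b))\<^sup>2"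
      by (simp add: abar_def sum_z field_simps)
    moreover have "(norm (y - z $ b))\<^sup>2 = (norm y)\<^sup>2 - 2 * (y \<bullet> z $ b) + (norm (z $ b))\<^sup>2"
      unfolding power2_norm_eq_inner
      by (simp add: inner_diff_left inner_diff_right inner_commute)
    ultimately show ?thesis by (simp add: K_def)
  qed
  \<comment> \<open>With exact squared distances the formula returns \<open>y\<close>, because
    \<open>transpose z ** z\<close> is the diagonal matrix of the \<open>lam d\<close>.\<close>
  have exact: "(\<Sum>b\<in>UNIV. z $ b $ d / lam d * (K + 2 * (y \<bullet> z $ b))) = 2 * y $ d" for d
  proof -
    have "(\<Sum>b\<in>UNIV. z $ b $ d * (y \<bullet> z $ b)) = (\<Sum>e\<in>UNIV. y $ e * (\<Sum>b\<in>UNIV. z $ b $ d * z $ b $ e))"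
      unfolding inner_vec_def sum_distrib_left
      by (subst sum.swap) (simp add: mult.left_commute)
    also have "\<dots> = y $ d * lam d"
      by (simp add: ortho if_distrib[of "\<lambda>t. _ * t"] cong: if_cong)
    finally have 1: "(\<Sum>b\<in>UNIV. z $ b $ d * (y \<bullet> z $ b)) = y $ d * lam d" .
    have "(\<Sum>b\<in>UNIV. z $ b $ d / lam d * (K + 2 * (y \<bullet> z $ b))) =
        (\<Sum>b\<in>UNIV. z $ b $ d) * (K / lam d) + (\<Sum>b\<in>UNIV. z $ b $ d * (y \<bullet> z $ b)) * (2 / lam d)"
      unfolding sum_distrib_right sum.distrib[symmetric]
      by (intro sum.cong refl) (simp add: distrib_left add_divide_distrib)
    then show ?thesis using centered 1 lam_pos[of d] by simp
  qed
  have comp: "\<bar>(gower_lateration z l - y) $ d\<bar> \<le> ?m * \<delta> / (2 * sqrt c)" for d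
  proof -
    have "(gower_lateration z l - y) $ d =
        (\<Sum>b\<in>UNIV. z $ b $ d / lam d * ((norm (y - z $ b))\<^sup>2 - (l $ b)\<^sup>2)) / 2"
    proof -
      have "(\<Sum>b\<in>UNIV. z $ b $ d / lam d * (abar $ b - (l $ b)\<^sup>2)) =
          (\<Sum>b\<in>UNIV. z $ b $ d / lam d * (K + 2 * (y \<bullet> z $ b))) +
          (\<Sum>b\<in>UNIV. z $ b $ d / lam d * ((norm (y - z $ b))\<^sup>2 - (l $ b)\<^sup>2))"
        unfolding sum.distrib[symmetric] abar[symmetric]
        by (intro sum.cong refl) (simp only: distrib_left[symmetric], simp)
      then show ?thesis unfolding vector_minus_component gower exact by linarith
    qed
    also have "\<bar>\<dots>\<bar> \<le> (?m * ((1 / sqrt c) * \<delta>)) / 2"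
    proof -
      \<comment> \<open>An entry is at most the column norm \<open>sqrt (lam d)\<close>; after
        division by \<open>lam d\<close>, only the lower bound \<open>c\<close> is needed.\<close>
      have "norm (z $ b $ d / lam d * ((norm (y - z $ b))\<^sup>2 - (l $ b)\<^sup>2)) \<le> (1 / sqrt c) * \<delta>" for b
      proof -
        have "\<bar>z $ b $ d\<bar> / lam d \<le> sqrt (lam d) / lam d"
          using abs_entry_le_sqrt[of z d "lam d" b] ortho[of d d] lam_pos[of d]
          by (simp add: divide_right_mono)
        also have "\<dots> = 1 / sqrt (lam d)"
          using lam_pos[of d] by (simp add: real_div_sqrt field_simps)
        also have "\<dots> \<le> 1 / sqrt c"
          using lam[of d] \<open>0 < c\<close> by (simp add: frac_le)
        finally have "\<bar>z $ b $ d / lam d\<bar> \<le> 1 / sqrt c"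
          using lam_pos[of d] by (simp add: abs_divide)
        then show ?thesis
          unfolding real_norm_def abs_mult using near[of b] \<open>0 < c\<close> by (intro mult_mono) simp_all
      qed
      then have "norm (\<Sum>b\<in>UNIV. z $ b $ d / lam d * ((norm (y - z $ b))\<^sup>2 - (l $ b)\<^sup>2)) \<le>
          of_nat CARD('m) * ((1 / sqrt c) * \<delta>)"
        by (rule sum_norm_bound)
      then show ?thesis by simp
    qed
    finally show ?thesis by (simp add: field_simps)
  qed
  have "norm (gower_lateration z l - y) \<le> (\<Sum>d\<in>UNIV. \<bar>(gower_lateration z l - y) $ d\<bar>)"
    by (rule norm_le_l1_cart)
  also have "\<dots> \<le> (\<Sum>d\<in>(UNIV :: 'k set). ?m * \<delta> / (2 * sqrt c))"
    using comp by (rule sum_mono)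
  finally show ?thesis by simp
qed

section \<open>Stability\<close>

lemma orthogonal_transformation_orthonormal_family:
  fixes g :: "'k \<Rightarrow> real ^ 'k"
  assumes "\<And>i j. g i \<bullet> g j = (if i = j then 1 else 0)"
  shows "orthogonal_transformation (\<lambda>x. \<Sum>d\<in>UNIV. x $ d *\<^sub>R g d)"
  unfolding orthogonal_transformation_def
proof (intro conjI allI)
  show "linear (\<lambda>x. \<Sum>d\<in>UNIV. x $ d *\<^sub>R g d)"
    by (intro linearI) (simp_all add: scaleR_add_left sum.distrib scaleR_sum_right)
  fix v w :: "real ^ 'k"
  have "(\<Sum>d\<in>UNIV. v $ d *\<^sub>R g d) \<bullet> (\<Sum>d\<in>UNIV. w $ d *\<^sub>R g d) =
      (\<Sum>e\<in>UNIV. \<Sum>d\<in>UNIV. if d = e then w $ e * v $ d else 0)"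
    by (simp add: inner_sum_left inner_sum_right assms if_distrib[of "\<lambda>t. _ * t"] cong: if_cong)
  then show "(\<Sum>d\<in>UNIV. v $ d *\<^sub>R g d) \<bullet> (\<Sum>d\<in>UNIV. w $ d *\<^sub>R g d) = v \<bullet> w"
    by (simp add: inner_vec_def) (intro sum.cong refl mult.commute)
qed

text \<open>The orthogonal map \<open>T\<close> is the Gram--Schmidt correction of the linear map
  \<open>F\<close>. The constant is uniform over the configuration, the dissimilarities and the
  choice of the embedding \<open>z\<close>.\<close>

lemma classical_scaling_stable:
  assumes m: "CARD('m::finite) = CARD('k::finite) + 1" and "0 < c" "0 \<le> R"
  shows "\<exists>K>0. \<forall>(u :: 'm \<Rightarrow> real ^ 'k) (\<Lambda> :: real ^ 'm ^ 'm) (z :: real ^ 'k ^ 'm) \<eta>.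
    0 \<le> \<eta> \<longrightarrow> K * \<eta> \<le> 1 \<longrightarrow>
    (\<forall>a b. norm (u a - u b) \<le> R \<and> \<bar>\<Lambda> $ a $ b - norm (u a - u b)\<bar> \<le> \<eta>) \<longrightarrow>
    coercive_on_centered c \<Lambda> \<longrightarrow> classical_scaling \<Lambda> z \<longrightarrow>
    (\<exists>T ubar. orthogonal_transformation T \<and>
       (\<forall>a. norm (u a - ubar - T (z $ a)) \<le> K * \<eta>))"
proof -
  let ?m = "real CARD('m)"
  obtain K0 where "K0 \<ge> 1" and K0: "\<forall>(f :: 'k \<Rightarrow> real ^ 'k) \<eta>. 0 \<le> \<eta> \<longrightarrow> K0 * \<eta> \<le> 1 \<longrightarrow>
    (\<forall>i\<in>UNIV. \<forall>j\<in>UNIV. \<bar>f i \<bullet> f j - (if i = j then 1 else 0)\<bar> \<le> \<eta>) \<longrightarrow>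
    (\<exists>g. (\<forall>i\<in>UNIV. \<forall>j\<in>UNIV. g i \<bullet> g j = (if i = j then 1 else 0)) \<and>
         (\<forall>i\<in>UNIV. norm (f i - g i) \<le> K0 * \<eta>))"
    using near_orthonormal_family[of "UNIV :: 'k set", where 'a = "real ^ 'k"] by auto
  \<comment> \<open>\<open>S\<close> bounds \<open>sqrt (lam d)\<close> and hence all entries of
    \<open>z\<close>; \<open>L * \<eta>\<close> bounds the failure of the \<open>f d\<close> to be
    orthonormal; \<open>K\<close> then sums \<open>k\<close> errors, each an entry of
    \<open>z\<close> times a Gram--Schmidt correction.\<close>
  define S where "S = ?m * (R + 1)"
  define L where "L = ?m\<^sup>2 * (2 * R + 1) / (2 * c)"
  define K where "K = 1 + K0 * L + real CARD('k) * (S * (K0 * L))"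
  have S: "0 \<le> S" using \<open>0 \<le> R\<close> by (simp add: S_def)
  have L: "0 \<le> L" using \<open>0 \<le> R\<close> \<open>0 < c\<close> by (simp add: L_def)
  have K0L: "0 \<le> K0 * L" using L \<open>K0 \<ge> 1\<close> by simp
  have K1: "0 \<le> real CARD('k) * (S * (K0 * L))"
    using K0L S by simp
  have K: "1 \<le> K" "K0 * L \<le> K" "real CARD('k) * (S * (K0 * L)) \<le> K"
    using K0L K1 by (auto simp: K_def)
  show ?thesis
  proof (intro exI[of _ K] conjI allI impI)
    show "0 < K" using K by simp
    fix u :: "'m \<Rightarrow> real ^ 'k" and \<Lambda> :: "real ^ 'm ^ 'm" and z :: "real ^ 'k ^ 'm" and \<eta> :: real
    assume \<eta>: "0 \<le> \<eta>" "K * \<eta> \<le> 1"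
      and u: "\<forall>a b. norm (u a - u b) \<le> R \<and> \<bar>\<Lambda> $ a $ b - norm (u a - u b)\<bar> \<le> \<eta>"
      and coercive: "coercive_on_centered c \<Lambda>" and scaling: "classical_scaling \<Lambda> z"
    have "\<eta> \<le> 1" using mult_right_mono[OF K(1) \<eta>(1)] \<eta>(2) by simp
    obtain lam :: "'k \<Rightarrow> real" where lam: "\<And>d. c \<le> lam d"
      and centered: "\<And>d. (\<Sum>a\<in>UNIV. z $ a $ d) = 0"
      and ortho: "\<And>d e. (\<Sum>a\<in>UNIV. z $ a $ d * z $ a $ e) = (if d = e then lam d else 0)"
      and quad: "\<And>d e. - (1 / 2) * quad_form \<Lambda> (column d z) (column e z) = (if d = e then (lam d)\<^sup>2 else 0)"
      and expand: "\<And>(w :: 'm \<Rightarrow> real ^ 'k) a. (\<Sum>b\<in>UNIV. w b) = 0 \<Longrightarrow>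
        (\<Sum>d\<in>UNIV. (z $ a $ d / lam d) *\<^sub>R (\<Sum>b\<in>UNIV. z $ b $ d *\<^sub>R w b)) = w a"
      by (rule classical_scaling_coerciveE[OF m scaling coercive \<open>0 < c\<close>, where 'a = "real ^ 'k"],
        rule that) simp_all
    have lam_pos: "0 < lam d" for d using lam[of d] \<open>0 < c\<close> by simp
    have entry: "\<bar>z $ a $ d\<bar> \<le> sqrt (lam d)" for a d
      using abs_entry_le_sqrt[of z d "lam d" a] ortho[of d d] by simp
    have col: "\<bar>column d z $ a\<bar> \<le> sqrt (lam d)" for a d
      using entry by (simp add: column_def)
    \<comment> \<open>An upper bound for the eigenvalues: comparing \<open>\<Lambda>\<close> with
      the zero matrix turns the perturbation estimate into a bound for the form itself, where the
      square of \<open>lam d\<close> is estimated by a multiple of \<open>lam d\<close>.\<close>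
    have sqrt_lam: "sqrt (lam d) \<le> S" for d
    proof -
      have "\<bar>(\<Lambda> $ a $ b)\<^sup>2 - ((0 :: real ^ 'm ^ 'm) $ a $ b)\<^sup>2\<bar> \<le> (R + 1)\<^sup>2" for a b
      proof -
        have "\<bar>\<Lambda> $ a $ b\<bar> \<le> \<bar>R + 1\<bar>"
          using u[rule_format, of a b] norm_ge_zero[of "u a - u b"] \<open>\<eta> \<le> 1\<close> by linarith
        then show ?thesis by (simp add: abs_le_square_iff)
      qed
      from quad_form_perturb[OF this col[of d] col[of d]]
      have "\<bar>quad_form \<Lambda> (column d z) (column d z)\<bar> \<le> ?m\<^sup>2 * (lam d * (R + 1)\<^sup>2)"
        using lam_pos[of d] by (simp add: quad_form_def)
      moreover have "2 * (lam d)\<^sup>2 = - quad_form \<Lambda> (column d z) (column d z)"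
        using quad[of d d] by simp
      ultimately have "(lam d)\<^sup>2 \<le> ?m\<^sup>2 * (lam d * (R + 1)\<^sup>2)"
        using zero_le_power2[of "lam d"] by linarith
      then have "lam d * lam d \<le> lam d * S\<^sup>2"
        by (simp add: S_def power_mult_distrib power2_eq_square mult_ac)
      then have "lam d \<le> S\<^sup>2" using lam_pos[of d] by simp
      then show ?thesis using S real_le_lsqrt by blast
    qed
    \<comment> \<open>\<open>f d\<close> is the image of the \<open>d\<close>-th coordinate vector
      under \<open>F\<close>.\<close>
    define f where "f = (\<lambda>d. (1 / lam d) *\<^sub>R (\<Sum>a\<in>UNIV. z $ a $ d *\<^sub>R u a))"
    have f: "\<bar>f d \<bullet> f e - (if d = e then 1 else 0)\<bar> \<le> L * \<eta>" for d e
    proof -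
      let ?D = "\<chi> a b. norm (u a - u b)"
      have "(\<Sum>a\<in>UNIV. z $ a $ d *\<^sub>R u a) \<bullet> (\<Sum>a\<in>UNIV. z $ a $ e *\<^sub>R u a) =
          - (1 / 2) * quad_form ?D (column d z) (column e z)"
        using quad_form_dist[of "column d z" "column e z" u] centered by (simp add: column_def)
      then have "f d \<bullet> f e - (if d = e then 1 else 0) =
          (- (1 / 2) * quad_form ?D (column d z) (column e z) - (if d = e then (lam d)\<^sup>2 else 0)) / (lam d * lam e)"
        using lam_pos[of d] lam_pos[of e]
        by (simp add: f_def power2_eq_square field_simps)
      also have "\<dots> = (quad_form \<Lambda> (column d z) (column e z) - quad_form ?D (column d z) (column e z))
          / (2 * (lam d * lam e))"
        unfolding quad[symmetric] by (simp add: field_simps)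
      finally have eq: "f d \<bullet> f e - (if d = e then 1 else 0) = \<dots>" .
      have "\<bar>(\<Lambda> $ a $ b)\<^sup>2 - (?D $ a $ b)\<^sup>2\<bar> \<le> (2 * R + 1) * \<eta>" for a b
      proof -
        have "\<bar>(\<Lambda> $ a $ b)\<^sup>2 - (norm (u a - u b))\<^sup>2\<bar> \<le> \<eta> * (2 * R + \<eta>)"
          using u by (intro abs_power2_diff_le) auto
        also have "\<dots> \<le> \<eta> * (2 * R + 1)"
          using \<eta>(1) \<open>\<eta> \<le> 1\<close> by (intro mult_left_mono) auto
        finally show ?thesis by (simp add: mult.commute)
      qed
      from quad_form_perturb[OF this col[of d] col[of e]]
      have "\<bar>f d \<bullet> f e - (if d = e then 1 else 0)\<bar> \<le>
          ?m\<^sup>2 * (sqrt (lam d) * sqrt (lam e) * ((2 * R + 1) * \<eta>)) / (2 * (lam d * lam e))"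
        unfolding eq using lam_pos[of d] lam_pos[of e]
        by (simp add: abs_mult divide_right_mono)
      \<comment> \<open>The entries of the two columns contribute half of the eigenvalues in the
        denominator, so a lower bound on the remaining square roots suffices.\<close>
      also have "\<dots> = ?m\<^sup>2 * ((2 * R + 1) * \<eta>) / (2 * (sqrt (lam d) * sqrt (lam e)))"
      proof -
        have "M * (s * t * X) / (2 * ((s * s) * (t * t))) = M * X / (2 * (s * t))"
          if "s \<noteq> 0" "t \<noteq> 0" for M s t X :: real
          using that by simp
        from this[of "sqrt (lam d)" "sqrt (lam e)"] show ?thesis
          using lam_pos[of d] lam_pos[of e] by simp
      qed
      also have "\<dots> \<le> ?m\<^sup>2 * ((2 * R + 1) * \<eta>) / (2 * (sqrt c * sqrt c))"
        using lam[of d] lam[of e] \<open>0 < c\<close> \<eta>(1) \<open>0 \<le> R\<close>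
        by (intro divide_left_mono mult_left_mono mult_mono mult_pos_pos) auto
      also have "\<dots> = L * \<eta>"
        using \<open>0 < c\<close> by (simp add: L_def)
      finally show ?thesis .
    qed
    have "K0 * (L * \<eta>) \<le> 1"
      using mult_right_mono[OF K(2) \<eta>(1)] \<eta>(2) by (simp add: mult.assoc)
    then obtain g where g: "\<And>i j. g i \<bullet> g j = (if i = j then 1 else 0)"
      and fg: "\<And>i. norm (f i - g i) \<le> K0 * (L * \<eta>)"
      using K0[rule_format, of "L * \<eta>" f] f L \<eta>(1) by auto
    define T where "T = (\<lambda>x :: real ^ 'k. \<Sum>d\<in>UNIV. x $ d *\<^sub>R g d)"
    define ubar where "ubar = (1 / ?m) *\<^sub>R (\<Sum>a\<in>UNIV. u a)"
    have w0: "(\<Sum>a\<in>UNIV. u a - ubar) = 0"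
      by (simp add: sum_subtractf ubar_def sum_constant_scaleR del: sum_constant)
    \<comment> \<open>An exact identity, whatever the error in \<open>\<Lambda>\<close>: the
      expansion applies to any centered family, and the shift by \<open>ubar\<close> drops out
      because the columns of \<open>z\<close> are centered.\<close>
    have w: "u a - ubar = (\<Sum>d\<in>UNIV. z $ a $ d *\<^sub>R f d)" for a
    proof -
      have "(\<Sum>b\<in>UNIV. z $ b $ d *\<^sub>R (u b - ubar)) = (\<Sum>b\<in>UNIV. z $ b $ d *\<^sub>R u b)" for d
        by (simp add: scaleR_diff_right sum_subtractf centered flip: scaleR_sum_left)
      then show ?thesis
        using expand[OF w0, of a] by (simp add: f_def)
    qed
    have "norm (u a - ubar - T (z $ a)) \<le> K * \<eta>" for a
    proof -
      have "u a - ubar - T (z $ a) = (\<Sum>d\<in>UNIV. z $ a $ d *\<^sub>R (f d - g d))"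
        by (simp add: w T_def scaleR_diff_right sum_subtractf)
      also have "norm \<dots> \<le> real (card (UNIV :: 'k set)) * (S * (K0 * (L * \<eta>)))"
      proof (rule sum_norm_bound)
        fix d
        show "norm (z $ a $ d *\<^sub>R (f d - g d)) \<le> S * (K0 * (L * \<eta>))"
          unfolding norm_scaleR
          using fg[of d] order_trans[OF entry sqrt_lam, of a d] S by (intro mult_mono) auto
      qed
      also have "\<dots> \<le> K * \<eta>"
        using mult_right_mono[OF K(3) \<eta>(1)] by (simp add: mult_ac)
      finally show ?thesis .
    qed
    moreover have "orthogonal_transformation T"
      unfolding T_def by (rule orthogonal_transformation_orthonormal_family[OF g])
    ultimately show "\<exists>T ubar. orthogonal_transformation T \<and>
        (\<forall>a. norm (u a - ubar - T (z $ a)) \<le> K * \<eta>)" by blast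
  qed
qed

text \<open>The rigid motion found for the landmarks also serves the other points: it carries a true
  point to a target whose distances to the embedded landmarks nearly agree with the dissimilarities,
  and lateration is stable.\<close>

lemma landmark_classical_scaling_stable:
  assumes m: "CARD('m::finite) = CARD('k::finite) + 1" and "0 < c" "0 \<le> R"
  shows "\<exists>K>0. \<forall>n (u :: nat \<Rightarrow> real ^ 'k) dhat (l :: 'm \<Rightarrow> nat) uhat \<eta>.
    0 \<le> \<eta> \<longrightarrow> K * \<eta> \<le> 1 \<longrightarrow>
    (\<forall>i\<in>{1..n}. \<forall>j\<in>{1..n}. norm (u i - u j) \<le> R \<and> \<bar>dhat i j - norm (u i - u j)\<bar> \<le> \<eta>) \<longrightarrow>
    item_tuple n l \<longrightarrow> coercive_on_centered c (restrict_diss dhat l) \<longrightarrow>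
    landmark_classical_scaling n dhat l uhat \<longrightarrow>
    (\<exists>Q\<in>rigid_transformations. \<forall>i\<in>{1..n}. norm (uhat i - Q (u i)) \<le> K * \<eta>)"
proof -
  obtain K1 where "K1 > 0" and K1: "\<forall>(u :: 'm \<Rightarrow> real ^ 'k) (\<Lambda> :: real ^ 'm ^ 'm) (z :: real ^ 'k ^ 'm) \<eta>.
    0 \<le> \<eta> \<longrightarrow> K1 * \<eta> \<le> 1 \<longrightarrow>
    (\<forall>a b. norm (u a - u b) \<le> R \<and> \<bar>\<Lambda> $ a $ b - norm (u a - u b)\<bar> \<le> \<eta>) \<longrightarrow>
    coercive_on_centered c \<Lambda> \<longrightarrow> classical_scaling \<Lambda> z \<longrightarrow>
    (\<exists>T ubar. orthogonal_transformation T \<and>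
       (\<forall>a. norm (u a - ubar - T (z $ a)) \<le> K1 * \<eta>))"
    using classical_scaling_stable[OF assms] by (elim exE conjE)
  let ?m = "real CARD('m)"
  \<comment> \<open>The bound of \<open>gower_lateration_near\<close> for distances of size at most
    \<open>R + K1\<close> that are known up to \<open>(K1 + 1) * \<eta>\<close>.\<close>
  define K2 where "K2 = real CARD('k) * (?m * ((K1 + 1) * (2 * (R + K1) + (K1 + 1))) / (2 * sqrt c))"
  define K where "K = 1 + K1 + K2"
  have "0 \<le> K2" using \<open>K1 > 0\<close> \<open>0 \<le> R\<close> \<open>0 < c\<close> by (simp add: K2_def)
  then have K: "1 \<le> K" "K1 \<le> K" "K2 \<le> K" using \<open>K1 > 0\<close> by (auto simp: K_def)
  show ?thesis
  proof (intro exI[of _ K] conjI allI impI)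
    show "0 < K" using K by simp
    fix n and u :: "nat \<Rightarrow> real ^ 'k" and dhat and l :: "'m \<Rightarrow> nat" and uhat :: "nat \<Rightarrow> real ^ 'k" and \<eta> :: real
    assume \<eta>: "0 \<le> \<eta>" "K * \<eta> \<le> 1"
      and dhat: "\<forall>i\<in>{1..n}. \<forall>j\<in>{1..n}. norm (u i - u j) \<le> R \<and> \<bar>dhat i j - norm (u i - u j)\<bar> \<le> \<eta>"
      and l: "item_tuple n l" and coercive: "coercive_on_centered c (restrict_diss dhat l)"
      and lcs: "landmark_classical_scaling n dhat l uhat"
    have \<eta>1: "\<eta> \<le> 1" "K1 * \<eta> \<le> 1"
      using mult_right_mono[OF K(1) \<eta>(1)] mult_right_mono[OF K(2) \<eta>(1)] \<eta>(2) by auto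
    have l_in: "l a \<in> {1..n}" for a using l unfolding item_tuple_def by blast
    obtain z :: "real ^ 'k ^ 'm" where scaling: "classical_scaling (restrict_diss dhat l) z"
      and landmarks: "\<And>a. uhat (l a) = z $ a"
      and others: "\<And>p. p \<in> {1..n} - range l \<Longrightarrow> uhat p = gower_lateration z (\<chi> a. dhat p (l a))"
      using lcs unfolding landmark_classical_scaling_def by blast
    have "\<forall>a b. norm (u (l a) - u (l b)) \<le> R \<and>
        \<bar>restrict_diss dhat l $ a $ b - norm (u (l a) - u (l b))\<bar> \<le> \<eta>"
      using dhat l_in by (simp add: restrict_diss_def)
    then obtain T ubar where T: "orthogonal_transformation T"
      and near: "\<And>a. norm (u (l a) - ubar - T (z $ a)) \<le> K1 * \<eta>"
      using K1[rule_format, OF \<eta>(1) \<eta>1(2), of "\<lambda>a. u (l a)"] coercive scaling by blast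
    define S where "S = inv T"
    have S: "orthogonal_transformation S"
      unfolding S_def by (rule orthogonal_transformation_inv[OF T])
    have ST: "S (T v) = v" for v
      using orthogonal_transformation_inj[OF T] by (simp add: S_def)
    have linS: "linear S" using S by (simp add: orthogonal_transformation_def)
    \<comment> \<open>\<open>T\<close> leads from the embedding to the true points, so its inverse
      is taken.\<close>
    define Q where "Q = (\<lambda>v. S (v - ubar))"
    have "Q = (\<lambda>v. S (- ubar) + S v)"
      by (simp add: Q_def linear_diff[OF linS] linear_neg[OF linS])
    then have Q: "Q \<in> rigid_transformations"
      using S unfolding rigid_transformations_def by blast
    have Q_dist: "norm (Q v - Q w) = norm (v - w)" for v w
    proof -
      have "Q v - Q w = S (v - w)" by (simp add: Q_def linear_diff[OF linS])
      then show ?thesis by (simp add: orthogonal_transformation_norm[OF S])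
    qed
    have landmark_near: "norm (Q (u (l a)) - z $ a) \<le> K1 * \<eta>" for a
    proof -
      have "Q (u (l a)) - z $ a = S (u (l a) - ubar - T (z $ a))"
        by (simp add: Q_def linear_diff[OF linS] ST)
      then show ?thesis using near[of a] by (simp add: orthogonal_transformation_norm[OF S])
    qed
    obtain lam :: "'k \<Rightarrow> real" where lam: "\<And>d. c \<le> lam d"
      and centered: "\<And>d. (\<Sum>a\<in>UNIV. z $ a $ d) = 0"
      and ortho: "\<And>d e. (\<Sum>a\<in>UNIV. z $ a $ d * z $ a $ e) = (if d = e then lam d else 0)"
      by (rule classical_scaling_coerciveE[OF m scaling coercive \<open>0 < c\<close>, where 'a = real],
        rule that) simp_all
    have "norm (uhat i - Q (u i)) \<le> K * \<eta>" if i: "i \<in> {1..n}" for i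
    proof (cases "i \<in> range l")
      case True
      then obtain a where "i = l a" by blast
      then show ?thesis
        using landmark_near[of a] mult_right_mono[OF K(2) \<eta>(1)]
        by (simp add: landmarks norm_minus_commute)
    next
      case False
      have "\<bar>(norm (Q (u i) - z $ b))\<^sup>2 - ((\<chi> a. dhat i (l a)) $ b)\<^sup>2\<bar> \<le>
          ((K1 + 1) * (2 * (R + K1) + (K1 + 1))) * \<eta>" for b
      proof -
        \<comment> \<open>\<open>Q\<close> preserves distances, so only the displacement of the
          landmark contributes.\<close>
        have "\<bar>norm (Q (u i) - z $ b) - norm (u i - u (l b))\<bar> \<le> K1 * \<eta>"
          using norm_triangle_ineq3[of "Q (u i) - z $ b" "Q (u i) - Q (u (l b))"]
            landmark_near[of b] by (simp add: Q_dist)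
        moreover have "\<bar>dhat i (l b) - norm (u i - u (l b))\<bar> \<le> \<eta>" "norm (u i - u (l b)) \<le> R"
          using dhat i l_in by auto
        ultimately have 1: "\<bar>norm (Q (u i) - z $ b) - norm (u i - u (l b))\<bar> \<le> K1 * \<eta>"
          "\<bar>dhat i (l b) - norm (Q (u i) - z $ b)\<bar> \<le> (K1 + 1) * \<eta>"
          "norm (Q (u i) - z $ b) \<le> R + K1 * \<eta>"
          by (auto simp: algebra_simps)
        have "\<bar>(dhat i (l b))\<^sup>2 - (norm (Q (u i) - z $ b))\<^sup>2\<bar> \<le>
            (K1 + 1) * \<eta> * (2 * (R + K1 * \<eta>) + (K1 + 1) * \<eta>)"
          using 1 by (intro abs_power2_diff_le) auto
        \<comment> \<open>Since \<open>\<eta> \<le> 1\<close>, one factor \<open>\<eta>\<close> is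
          enough and the others are replaced by \<open>1\<close>.\<close>
        also have "\<dots> \<le> (K1 + 1) * \<eta> * (2 * (R + K1) + (K1 + 1))"
          using \<eta>(1) \<eta>1(1) \<open>K1 > 0\<close>
          by (intro mult_left_mono add_mono order_refl) (auto intro: mult_left_le)
        finally show ?thesis by (simp add: abs_minus_commute mult_ac)
      qed
      from gower_lateration_near[OF ortho centered lam \<open>0 < c\<close> this]
      have "norm (uhat i - Q (u i)) \<le> K2 * \<eta>"
        using others[of i] i False by (simp add: K2_def)
      then show ?thesis
        using mult_right_mono[OF K(3) \<eta>(1)] by linarith
    qed
    with Q show "\<exists>Q\<in>rigid_transformations. \<forall>i\<in>{1..n}. norm (uhat i - Q (u i)) \<le> K * \<eta>"
      by blast
  qed
qed

section \<open>Landmarks with large width\<close>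

text \<open>A corner \<open>p\<close> with one edge of length \<open>r\<close> along each axis. The
  combination of the vertices by \<open>x\<close> has the coordinates \<open>r * x $ a\<close> for
  all \<open>a\<close> except the corner, and the zero sum controls the corner coefficient by the
  others.\<close>

lemma nondegenerate_simplex_in_interior:
  fixes U :: "(real ^ 'k) set"
  assumes m: "CARD('m::finite) = CARD('k) + 1" and "interior U \<noteq> {}"
  obtains w :: "'m::finite \<Rightarrow> real ^ 'k" and c
  where "\<And>a. w a \<in> U" "0 < c" "coercive_on_centered c (\<chi> a b. norm (w a - w b))"
proof -
  obtain p r where "0 < r" and r: "cball p r \<subseteq> U"
    using assms(2) by (metis all_not_in_conv mem_interior_cball)
  \<comment> \<open>The index of the corner; the remaining \<open>k\<close> indices are matched with
    the axes.\<close>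
  define a0 :: 'm where "a0 = undefined"
  have "card (UNIV - {a0}) = card (UNIV :: 'k set)"
    using m by (simp add: card_Diff_singleton)
  then obtain \<sigma> where \<sigma>: "bij_betw \<sigma> (UNIV - {a0}) (UNIV :: 'k set)"
    by (metis finite finite_same_card_bij)
  define w where "w = (\<lambda>a. if a = a0 then p else p + r *\<^sub>R axis (\<sigma> a) 1)"
  have "w a \<in> U" for a
  proof -
    have "norm (r *\<^sub>R axis (\<sigma> a) (1 :: real)) \<le> r"
      using \<open>0 < r\<close> by (simp add: norm_axis_1)
    then have "w a \<in> cball p r"
      using \<open>0 < r\<close> by (auto simp: w_def dist_norm)
    then show ?thesis using r by blast
  qed
  moreover have "0 < r\<^sup>2 / real CARD('m)" using \<open>0 < r\<close> by simp
  moreover have "coercive_on_centered (r\<^sup>2 / real CARD('m)) (\<chi> a b. norm (w a - w b))"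
    unfolding coercive_on_centered_def
  proof (intro allI impI)
    fix x :: "real ^ 'm"
    assume x: "(\<Sum>a\<in>UNIV. x $ a) = 0"
    let ?A = "UNIV - {a0}"
    let ?N = "\<Sum>a\<in>?A. (x $ a)\<^sup>2"
    have split: "(\<Sum>a\<in>UNIV. h a) = h a0 + (\<Sum>a\<in>?A. h a)" for h :: "'m \<Rightarrow> 'z::comm_monoid_add"
      by (rule sum.remove) auto
    have "(\<Sum>a\<in>UNIV. x $ a *\<^sub>R w a) = (\<Sum>a\<in>UNIV. x $ a *\<^sub>R p + (if a = a0 then 0 else (r * x $ a) *\<^sub>R axis (\<sigma> a) 1))"
      by (intro sum.cong refl) (auto simp: w_def scaleR_add_right mult.commute)
    also have "\<dots> = (\<Sum>a\<in>UNIV. if a = a0 then 0 else (r * x $ a) *\<^sub>R axis (\<sigma> a) 1)"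
      using x by (simp only: sum.distrib scaleR_sum_left[symmetric]) simp
    also have "\<dots> = (\<Sum>a\<in>?A. (r * x $ a) *\<^sub>R axis (\<sigma> a) 1)"
      by (subst split) (auto intro: sum.cong)
    also have "\<dots> = (\<Sum>d\<in>UNIV. (r * x $ inv_into ?A \<sigma> d) *\<^sub>R axis d 1)"
      using bij_betw_imp_inj_on[OF \<sigma>]
      by (subst sum.reindex_bij_betw[OF \<sigma>, symmetric]) (intro sum.cong refl, simp)
    also have "\<dots> = (\<chi> d. r * x $ inv_into ?A \<sigma> d)"
      by (simp add: vec_eq_iff axis_def if_distrib[of "\<lambda>t. _ * t"] cong: if_cong)
    finally have comb: "(\<Sum>a\<in>UNIV. x $ a *\<^sub>R w a) = (\<chi> d. r * x $ inv_into ?A \<sigma> d)" .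
    have "(norm (\<Sum>a\<in>UNIV. x $ a *\<^sub>R w a))\<^sup>2 = (\<Sum>d\<in>UNIV. r\<^sup>2 * (x $ inv_into ?A \<sigma> d)\<^sup>2)"
      unfolding comb power2_norm_eq_inner by (simp add: inner_vec_def power2_eq_square mult_ac)
    also have "\<dots> = (\<Sum>a\<in>?A. r\<^sup>2 * (x $ a)\<^sup>2)"
      using bij_betw_imp_inj_on[OF \<sigma>]
      by (subst sum.reindex_bij_betw[OF \<sigma>, symmetric]) (intro sum.cong refl, simp)
    finally have norm_comb: "(norm (\<Sum>a\<in>UNIV. x $ a *\<^sub>R w a))\<^sup>2 = r\<^sup>2 * ?N"
      by (simp add: sum_distrib_left)
    have "x $ a0 = - (\<Sum>a\<in>?A. x $ a)" using x split[of "\<lambda>a. x $ a"] by simp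
    then have "(x $ a0)\<^sup>2 = (\<Sum>a\<in>?A. x $ a)\<^sup>2" by simp
    \<comment> \<open>Cauchy--Schwarz over \<open>k\<close> terms; together with \<open>?N\<close>
      itself this gives the factor \<open>k + 1 = m\<close>.\<close>
    also have "\<dots> \<le> real (card ?A) * ?N"
      using sum_squared_le_sum_of_squares[of "\<lambda>a. x $ a" ?A] by (simp add: mult.commute)
    finally have "(x $ a0)\<^sup>2 \<le> real CARD('k) * ?N" using m by simp
    moreover have "(norm x)\<^sup>2 = (x $ a0)\<^sup>2 + ?N"
      unfolding power2_norm_eq_inner
      by (simp add: inner_vec_def power2_eq_square split[of "\<lambda>a. x $ a * x $ a"])
    ultimately have "(norm x)\<^sup>2 \<le> real CARD('m) * ?N"
      using m by (simp add: algebra_simps)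
    then have "r\<^sup>2 / real CARD('m) * (norm x)\<^sup>2 \<le> r\<^sup>2 / real CARD('m) * (real CARD('m) * ?N)"
      by (intro mult_left_mono) auto
    also have "\<dots> = - (1 / 2) * quad_form (\<chi> a b. norm (w a - w b)) x x"
      using quad_form_dist[OF x x, of w] norm_comb by (simp add: power2_norm_eq_inner)
    finally show "r\<^sup>2 / real CARD('m) * (norm x)\<^sup>2 \<le> - (1 / 2) * quad_form (\<chi> a b. norm (w a - w b)) x x" .
  qed
  ultimately show thesis by (rule that)
qed

text \<open>The coordinates of \<open>x\<close> are at most \<open>norm x\<close>, so the form
  changes by at most \<open>c\<close> times the squared norm; the prefactor \<open>1 / 2\<close>
  makes this a loss of only half of \<open>c\<close>.\<close>

lemma coercive_on_centered_perturb:
  fixes \<Lambda> \<Lambda>' :: "real ^ 'm ^ 'm"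
  assumes coercive: "coercive_on_centered c \<Lambda>"
    and near: "\<And>a b. \<bar>(\<Lambda> $ a $ b)\<^sup>2 - (\<Lambda>' $ a $ b)\<^sup>2\<bar> \<le> \<delta>" and \<delta>: "(real CARD('m))\<^sup>2 * \<delta> \<le> c"
  shows "coercive_on_centered (c / 2) \<Lambda>'"
  unfolding coercive_on_centered_def
proof (intro allI impI)
  fix x :: "real ^ 'm"
  assume x: "(\<Sum>a\<in>UNIV. x $ a) = 0"
  have "\<bar>quad_form \<Lambda> x x - quad_form \<Lambda>' x x\<bar> \<le> (real CARD('m))\<^sup>2 * (norm x * norm x * \<delta>)"
    by (intro quad_form_perturb near component_le_norm_cart)
  also have "\<dots> \<le> c * (norm x)\<^sup>2"
    using mult_right_mono[OF \<delta>, of "(norm x)\<^sup>2"] by (simp add: power2_eq_square mult_ac)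
  finally have "\<bar>quad_form \<Lambda> x x - quad_form \<Lambda>' x x\<bar> \<le> c * (norm x)\<^sup>2" .
  moreover have "c * (norm x)\<^sup>2 \<le> - (1 / 2) * quad_form \<Lambda> x x"
    using coercive x by (simp add: coercive_on_centered_def)
  ultimately show "c / 2 * (norm x)\<^sup>2 \<le> - (1 / 2) * quad_form \<Lambda>' x x"
    by (simp add: abs_le_iff)
qed

text \<open>Coercivity is tested on the difference of two axis vectors. The separation ensures that
  different vertices are approximated by different sample points.\<close>

lemma coercive_dist_separated:
  fixes w :: "'m::finite \<Rightarrow> 'a::real_inner"
  assumes "coercive_on_centered c (\<chi> a b. norm (w a - w b))" "a \<noteq> b"
  shows "2 * c \<le> (norm (w a - w b))\<^sup>2"
proof -
  define x :: "real ^ 'm" where "x = axis a 1 - axis b 1"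
  have x0: "(\<Sum>i\<in>UNIV. x $ i) = 0"
    by (simp add: x_def sum_subtractf axis_def)
  have "(norm x)\<^sup>2 = 2"
    using assms(2) unfolding x_def power2_norm_eq_inner
    by (simp add: inner_diff_left inner_diff_right inner_axis_axis)
  moreover have "(\<Sum>i\<in>UNIV. x $ i *\<^sub>R w i) = w a - w b"
  proof -
    have "(\<Sum>i\<in>UNIV. x $ i *\<^sub>R w i) = (\<Sum>i\<in>UNIV. (if i = a then w i else 0) - (if i = b then w i else 0))"
      by (intro sum.cong refl) (auto simp: x_def axis_def)
    then show ?thesis by (simp add: sum_subtractf)
  qed
  ultimately show ?thesis
    using assms(1) x0 quad_form_dist[OF x0 x0, of w]
    by (auto simp: coercive_on_centered_def power2_norm_eq_inner mult.commute)
qed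

section \<open>The inverse of the parametrization\<close>

lemma flat_parametrization_inj_on:
  assumes "flat_parametrization M U \<phi>"
  shows "inj_on \<phi> U"
proof (rule inj_onI)
  fix u u' assume u: "u \<in> U" "u' \<in> U" "\<phi> u = \<phi> u'"
  then have "ennreal (norm (u - u')) = ennreal (norm (u - u))"
    using assms unfolding flat_parametrization_def by metis
  then show "u = u'" by simp
qed

lemma flat_parametrization_inv:
  assumes "flat_parametrization M U \<phi>" "p \<in> M"
  shows "the_inv_into U \<phi> p \<in> U" "\<phi> (the_inv_into U \<phi> p) = p"
  using assms flat_parametrization_inj_on[OF assms(1)]
  by (auto simp: flat_parametrization_def intro: the_inv_into_into f_the_inv_into_f)

text \<open>The right-hand side involves only \<open>M\<close>, so distances between parameters are
  the same for every parametrization.\<close>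

lemma flat_parametrization_dist:
  assumes "flat_parametrization M U \<phi>" "p \<in> M" "q \<in> M"
  shows "norm (the_inv_into U \<phi> p - the_inv_into U \<phi> q) = enn2real (intrinsic_dist M p q)"
proof -
  have "intrinsic_dist M (\<phi> (the_inv_into U \<phi> p)) (\<phi> (the_inv_into U \<phi> q)) =
      ennreal (norm (the_inv_into U \<phi> p - the_inv_into U \<phi> q))"
    using assms flat_parametrization_inv unfolding flat_parametrization_def by blast
  then show ?thesis
    using flat_parametrization_inv(2)[OF assms(1)] assms(2,3) by simp
qed

text \<open>The inverse of a continuous injection on a compact set is continuous, and its domain
  \<open>M\<close> is compact. This converts density of the sample in the ambient norm into
  closeness of parameters.\<close>

lemma flat_parametrization_inv_uniformly_continuous:
  assumes flat: "flat_parametrization M U \<phi>" and "0 < \<theta>"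
  obtains \<delta> where "0 < \<delta>"
    "\<And>p q. p \<in> M \<Longrightarrow> q \<in> M \<Longrightarrow> norm (p - q) \<le> \<delta> \<Longrightarrow>
      norm (the_inv_into U \<phi> p - the_inv_into U \<phi> q) < \<theta>"
proof -
  obtain W where "U \<subseteq> W" "C2_on W \<phi>"
    using flat unfolding flat_parametrization_def by blast
  then have cont: "continuous_on U \<phi>"
    unfolding C2_on_def
    by (meson continuous_at_imp_continuous_on has_derivative_continuous subsetD)
  have "compact U" and M: "\<phi> ` U = M"
    using flat by (auto simp: flat_parametrization_def)
  have "the_inv_into U \<phi> (\<phi> u) = u" if "u \<in> U" for u
    using flat_parametrization_inj_on[OF flat] that by (rule the_inv_into_f_f)
  then have "continuous_on M (the_inv_into U \<phi>)"
    using continuous_on_inv[OF cont \<open>compact U\<close>] M by metis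
  moreover have "compact M"
    using compact_continuous_image[OF cont \<open>compact U\<close>] M by simp
  ultimately have "uniformly_continuous_on M (the_inv_into U \<phi>)"
    by (rule compact_uniformly_continuous)
  then obtain d where "d > 0" and d: "\<And>p q. p \<in> M \<Longrightarrow> q \<in> M \<Longrightarrow> dist q p < d \<Longrightarrow>
      dist (the_inv_into U \<phi> q) (the_inv_into U \<phi> p) < \<theta>"
    using \<open>0 < \<theta>\<close> unfolding uniformly_continuous_on_def by metis
  show thesis
  proof (rule that[of "d / 2"])
    show "0 < d / 2" using \<open>d > 0\<close> by simp
    fix p q assume "p \<in> M" "q \<in> M" "norm (p - q) \<le> d / 2"
    then show "norm (the_inv_into U \<phi> p - the_inv_into U \<phi> q) < \<theta>"
      using d[of q p] \<open>d > 0\<close> by (simp add: dist_norm)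
  qed
qed

text \<open>Sample points near the images of the vertices of a fixed simplex in \<open>U\<close>
  inherit half of its coercivity. The three constants are fixed before the sample and the
  dissimilarities.\<close>

lemma exists_coercive_landmarks:
  fixes M :: "(real ^ 'd::finite) set" and U :: "(real ^ 'k) set"
  assumes m: "CARD('m::finite) = CARD('k) + 1" and flat: "flat_parametrization M U \<phi>"
  shows "\<exists>c>0. \<exists>\<delta>>0. \<exists>\<eta>\<^sub>0>0. \<forall>n (x :: nat \<Rightarrow> real ^ 'd) \<epsilon> \<eta> dhat.
    (\<forall>i\<in>{1..n}. x i \<in> M) \<longrightarrow> (\<forall>p\<in>M. \<exists>i\<in>{1..n}. norm (p - x i) \<le> \<epsilon>) \<longrightarrow>
    \<epsilon> \<le> \<delta> \<longrightarrow> \<eta> \<le> \<eta>\<^sub>0 \<longrightarrow>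
    (\<forall>i\<in>{1..n}. \<forall>j\<in>{1..n}. \<bar>enn2real (intrinsic_dist M (x i) (x j)) - dhat i j\<bar> \<le> \<eta>) \<longrightarrow>
    (\<exists>l :: 'm \<Rightarrow> nat. item_tuple n l \<and> coercive_on_centered c (restrict_diss dhat l))"
proof -
  have "interior U \<noteq> {}" and "bounded U" and M: "\<phi> ` U = M"
    using flat by (auto simp: flat_parametrization_def compact_imp_bounded)
  obtain w :: "'m \<Rightarrow> real ^ 'k" and c where w: "\<And>a. w a \<in> U" and "0 < c"
    and coercive: "coercive_on_centered c (\<chi> a b. norm (w a - w b))"
    using nondegenerate_simplex_in_interior[OF m \<open>interior U \<noteq> {}\<close>] by blast
  obtain R where R: "\<And>u. u \<in> U \<Longrightarrow> norm u \<le> R"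
    using \<open>bounded U\<close> by (auto simp: bounded_iff)
  have "0 \<le> R" using R[OF w[of undefined]] norm_ge_zero order_trans by blast
  let ?m = "real CARD('m)"
  \<comment> \<open>The allowed error in the simplex distances: below \<open>sqrt c\<close> so that
    labels stay distinct, below the last term so that coercivity survives, and at most
    \<open>1\<close> to linearize the squared error. It is split into thirds: two for moving a pair
    of vertices, one for the dissimilarities.\<close>
  define e where "e = min 1 (min (sqrt c) (c / (?m\<^sup>2 * (4 * R + 1))))"
  have e: "0 < e" "e \<le> 1" "e \<le> sqrt c" "e \<le> c / (?m\<^sup>2 * (4 * R + 1))"
    using \<open>0 < c\<close> \<open>0 \<le> R\<close> by (auto simp: e_def)
  have e_small: "?m\<^sup>2 * (e * (2 * (2 * R) + e)) \<le> c"
  proof -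
    have "?m\<^sup>2 * (e * (2 * (2 * R) + e)) \<le> ?m\<^sup>2 * (e * (4 * R + 1))"
      using e \<open>0 \<le> R\<close> by (intro mult_left_mono) auto
    also have "\<dots> = e * (?m\<^sup>2 * (4 * R + 1))" by (simp only: mult.left_commute)
    also have "\<dots> \<le> c"
      using e(4) \<open>0 \<le> R\<close> by (subst (asm) pos_le_divide_eq) auto
    finally show ?thesis .
  qed
  obtain \<delta> where "0 < \<delta>" and \<delta>: "\<And>p q. p \<in> M \<Longrightarrow> q \<in> M \<Longrightarrow> norm (p - q) \<le> \<delta> \<Longrightarrow>
      norm (the_inv_into U \<phi> p - the_inv_into U \<phi> q) < e / 3"
    using flat_parametrization_inv_uniformly_continuous[OF flat, of "e / 3"] e(1) by auto
  have w_inv: "the_inv_into U \<phi> (\<phi> (w a)) = w a" for a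
    using flat_parametrization_inj_on[OF flat] w by (simp add: the_inv_into_f_f)
  have w_in: "\<phi> (w a) \<in> M" for a using M w by blast
  show ?thesis
  proof (rule exI[of _ "c / 2"], intro conjI, use \<open>0 < c\<close> in simp,
      rule exI[of _ \<delta>], intro conjI, fact, rule exI[of _ "e / 3"], intro conjI allI impI, use e in simp)
    fix n and x :: "nat \<Rightarrow> real ^ 'd" and \<epsilon> \<eta> :: real and dhat
    assume x: "\<forall>i\<in>{1..n}. x i \<in> M" and cover: "\<forall>p\<in>M. \<exists>i\<in>{1..n}. norm (p - x i) \<le> \<epsilon>"
      and "\<epsilon> \<le> \<delta>" "\<eta> \<le> e / 3"
      and dhat: "\<forall>i\<in>{1..n}. \<forall>j\<in>{1..n}. \<bar>enn2real (intrinsic_dist M (x i) (x j)) - dhat i j\<bar> \<le> \<eta>"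
    have "\<forall>a. \<exists>i\<in>{1..n}. norm (\<phi> (w a) - x i) \<le> \<epsilon>"
      using cover w_in by blast
    then obtain l :: "'m \<Rightarrow> nat" where l: "\<And>a. l a \<in> {1..n}" "\<And>a. norm (\<phi> (w a) - x (l a)) \<le> \<epsilon>"
      by metis
    define v where "v = (\<lambda>a. the_inv_into U \<phi> (x (l a)))"
    have near: "norm (w a - v a) < e / 3" for a
      using \<delta>[of "\<phi> (w a)" "x (l a)"] w_in x l[of a] \<open>\<epsilon> \<le> \<delta>\<close> by (force simp: w_inv v_def)
    \<comment> \<open>Vertices sharing a sample point would be closer than \<open>sqrt c\<close>,
      while coercivity separates their squared distance by \<open>2 * c\<close>.\<close>
    have "inj l"
    proof (rule injI, rule ccontr)
      fix a b assume "l a = l b" "a \<noteq> b"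
      then have "norm (w a - w b) < e"
        using norm_triangle_ineq4[of "w a - v a" "w b - v b"] near[of a] near[of b] e(1)
        by (simp add: v_def)
      then have "(norm (w a - w b))\<^sup>2 < e\<^sup>2"
        using e(1) by (intro power_strict_mono) auto
      also have "\<dots> \<le> (sqrt c)\<^sup>2"
        using e by (intro power_mono) auto
      finally show False
        using coercive_dist_separated[OF coercive \<open>a \<noteq> b\<close>] \<open>0 < c\<close> by simp
    qed
    moreover have "coercive_on_centered (c / 2) (restrict_diss dhat l)"
    proof (rule coercive_on_centered_perturb[OF coercive _ e_small])
      fix a b
      have "\<bar>norm (v a - v b) - dhat (l a) (l b)\<bar> \<le> \<eta>"
        using dhat l(1) x by (simp add: v_def flat_parametrization_dist[OF flat])
      moreover have "\<bar>norm (w a - w b) - norm (v a - v b)\<bar> \<le> 2 * (e / 3)"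
        using norm_triangle_ineq3[of "w a - w b" "v a - v b"]
          norm_triangle_ineq4[of "w a - v a" "w b - v b"] near[of a] near[of b]
        by (simp add: algebra_simps)
      ultimately have "\<bar>dhat (l a) (l b) - norm (w a - w b)\<bar> \<le> e"
        using \<open>\<eta> \<le> e / 3\<close> by linarith
      moreover have "norm (w a - w b) \<le> 2 * R"
        using norm_triangle_ineq4[of "w a" "w b"] R[OF w[of a]] R[OF w[of b]] by linarith
      ultimately show "\<bar>((\<chi> a b. norm (w a - w b)) $ a $ b)\<^sup>2 - (restrict_diss dhat l $ a $ b)\<^sup>2\<bar>
          \<le> e * (2 * (2 * R) + e)"
        using abs_power2_diff_le[of "dhat (l a) (l b)" "norm (w a - w b)" e "2 * R"]
        by (simp add: restrict_diss_def abs_minus_commute)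
    qed
    ultimately show "\<exists>l :: 'm \<Rightarrow> nat. item_tuple n l \<and> coercive_on_centered (c / 2) (restrict_diss dhat l)"
      using l(1) by (auto simp: item_tuple_def)
  qed
qed

section \<open>Uniform constants and the final error bound\<close>

theorem theorem5p5:
  fixes M :: "(real ^ 'd::finite) set" and C\<^sub>0 :: real
  assumes "CARD('m::finite) = CARD('k::finite) + 1"
  shows "\<exists>C>0. \<forall>(U :: (real ^ 'k) set) (\<phi> :: real ^ 'k \<Rightarrow> real ^ 'd)
           (n :: nat) (x :: nat \<Rightarrow> real ^ 'd) (\<epsilon> :: real) (dhat :: nat \<Rightarrow> nat \<Rightarrow> real)
           (Y :: ('m \<Rightarrow> nat) \<Rightarrow> real ^ 'k ^ 'm) (l :: 'm \<Rightarrow> nat) (uhat :: nat \<Rightarrow> real ^ 'k).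
           flat_parametrization M U \<phi> \<longrightarrow>
           n \<ge> 1 \<longrightarrow>
           (\<forall>i\<in>{1..n}. x i \<in> M) \<longrightarrow>
           (\<forall>p\<in>M. (MIN i\<in>{1..n}. norm (p - x i)) \<le> \<epsilon>) \<longrightarrow>
           (\<forall>i\<in>{1..n}. \<forall>j\<in>{1..n}. dhat i j \<ge> 0 \<and> dhat i j = dhat j i) \<longrightarrow>
           (\<forall>i\<in>{1..n}. \<forall>j\<in>{1..n}.
              \<bar>enn2real (intrinsic_dist M (x i) (x j)) - dhat i j\<bar>
                \<le> C\<^sub>0 * \<epsilon>\<^sup>2 * min (enn2real (intrinsic_dist M (x i) (x j))) (dhat i j)) \<longrightarrow>
           largest_width_landmarks n dhat Y l \<longrightarrow>
           landmark_classical_scaling n dhat l uhat \<longrightarrow>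
           \<epsilon> \<le> 1 / C \<longrightarrow>
           (\<exists>Q\<in>rigid_transformations.
              (MAX i\<in>{1..n}. norm (uhat i - Q (the_inv_into U \<phi> (x i)))) \<le> C * \<epsilon>\<^sup>2)"
proof (cases "\<exists>(U :: (real ^ 'k) set) \<phi>. flat_parametrization M U \<phi>")
  case False
  \<comment> \<open>Without any parametrization the claim is vacuous, so every positive constant
    will do.\<close>
  then show ?thesis by (intro exI[of _ 1]) simp
next
  case True
  \<comment> \<open>\<open>C\<close> must be chosen before \<open>U\<close> and
    \<open>\<phi>\<close>, so the constants come from one fixed parametrization.\<close>
  then obtain U\<^sub>0 :: "(real ^ 'k) set" and \<phi>\<^sub>0 where flat0: "flat_parametrization M U\<^sub>0 \<phi>\<^sub>0" by blast
  obtain c \<delta> \<eta>\<^sub>0 where pos: "0 < c" "0 < \<delta>" "0 < \<eta>\<^sub>0"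
    and landmarks: "\<forall>n (x :: nat \<Rightarrow> real ^ 'd) \<epsilon> \<eta> dhat.
      (\<forall>i\<in>{1..n}. x i \<in> M) \<longrightarrow> (\<forall>p\<in>M. \<exists>i\<in>{1..n}. norm (p - x i) \<le> \<epsilon>) \<longrightarrow>
      \<epsilon> \<le> \<delta> \<longrightarrow> \<eta> \<le> \<eta>\<^sub>0 \<longrightarrow>
      (\<forall>i\<in>{1..n}. \<forall>j\<in>{1..n}. \<bar>enn2real (intrinsic_dist M (x i) (x j)) - dhat i j\<bar> \<le> \<eta>) \<longrightarrow>
      (\<exists>l :: 'm \<Rightarrow> nat. item_tuple n l \<and> coercive_on_centered c (restrict_diss dhat l))"
    using exists_coercive_landmarks[OF assms flat0] by (elim exE conjE)
  have "bounded U\<^sub>0"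
    using flat0 by (auto simp: flat_parametrization_def compact_imp_bounded)
  then obtain B where B: "\<And>u. u \<in> U\<^sub>0 \<Longrightarrow> norm u \<le> B"
    by (auto simp: bounded_iff)
  \<comment> \<open>A bound for the intrinsic diameter of \<open>M\<close>.\<close>
  define R where "R = 2 * \<bar>B\<bar>"
  have "0 \<le> R" by (simp add: R_def)
  have dist_le: "enn2real (intrinsic_dist M p q) \<le> R" if "p \<in> M" "q \<in> M" for p q
  proof -
    have "norm (the_inv_into U\<^sub>0 \<phi>\<^sub>0 p) \<le> B" "norm (the_inv_into U\<^sub>0 \<phi>\<^sub>0 q) \<le> B"
      using B flat_parametrization_inv(1)[OF flat0] that by auto
    then show ?thesis
      using norm_triangle_ineq4[of "the_inv_into U\<^sub>0 \<phi>\<^sub>0 p" "the_inv_into U\<^sub>0 \<phi>\<^sub>0 q"]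
        flat_parametrization_dist[OF flat0 that] by (simp add: R_def)
  qed
  obtain K where "0 < K" and stable: "\<forall>n (u :: nat \<Rightarrow> real ^ 'k) dhat (l :: 'm \<Rightarrow> nat) uhat \<eta>.
    0 \<le> \<eta> \<longrightarrow> K * \<eta> \<le> 1 \<longrightarrow>
    (\<forall>i\<in>{1..n}. \<forall>j\<in>{1..n}. norm (u i - u j) \<le> R \<and> \<bar>dhat i j - norm (u i - u j)\<bar> \<le> \<eta>) \<longrightarrow>
    item_tuple n l \<longrightarrow> coercive_on_centered c (restrict_diss dhat l) \<longrightarrow>
    landmark_classical_scaling n dhat l uhat \<longrightarrow>
    (\<exists>Q\<in>rigid_transformations. \<forall>i\<in>{1..n}. norm (uhat i - Q (u i)) \<le> K * \<eta>)"
    using landmark_classical_scaling_stable[OF assms \<open>0 < c\<close> \<open>0 \<le> R\<close>] by (elim exE conjE)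
  \<comment> \<open>The relative error becomes the absolute error
    \<open>D * \<epsilon>\<^sup>2\<close>, since the minimum is at most \<open>R\<close>. The
    absolute value covers a negative \<open>C\<^sub>0\<close>.\<close>
  define D where "D = \<bar>C\<^sub>0\<bar> * R"
  have "0 \<le> D" using \<open>0 \<le> R\<close> by (simp add: D_def)
  \<comment> \<open>The summands give, in turn, \<open>\<epsilon> \<le> 1\<close>,
    \<open>\<epsilon> \<le> \<delta>\<close>, \<open>\<eta> \<le> \<eta>\<^sub>0\<close>, and both
    \<open>K * \<eta> \<le> 1\<close> and the final estimate.\<close>
  define C where "C = 1 + 1 / \<delta> + D / \<eta>\<^sub>0 + K * D"
  have terms: "0 < 1 / \<delta>" "0 \<le> D / \<eta>\<^sub>0" "0 \<le> K * D"
    using pos \<open>0 \<le> D\<close> \<open>0 < K\<close> by auto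
  then have C: "1 \<le> C" "1 / \<delta> \<le> C" "D / \<eta>\<^sub>0 \<le> C" "K * D \<le> C"
    unfolding C_def by linarith+
  show ?thesis
  proof (intro exI[of _ C] conjI allI impI)
    show "0 < C" using C by simp
    fix U :: "(real ^ 'k) set" and \<phi> :: "real ^ 'k \<Rightarrow> real ^ 'd"
      and n :: nat and x :: "nat \<Rightarrow> real ^ 'd" and \<epsilon> :: real and dhat :: "nat \<Rightarrow> nat \<Rightarrow> real"
      and Y :: "('m \<Rightarrow> nat) \<Rightarrow> real ^ 'k ^ 'm" and l :: "'m \<Rightarrow> nat" and uhat :: "nat \<Rightarrow> real ^ 'k"
    assume flat: "flat_parametrization M U \<phi>" and "n \<ge> 1" and x: "\<forall>i\<in>{1..n}. x i \<in> M"
      and cover: "\<forall>p\<in>M. (MIN i\<in>{1..n}. norm (p - x i)) \<le> \<epsilon>"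
      and dhat: "\<forall>i\<in>{1..n}. \<forall>j\<in>{1..n}.
              \<bar>enn2real (intrinsic_dist M (x i) (x j)) - dhat i j\<bar>
                \<le> C\<^sub>0 * \<epsilon>\<^sup>2 * min (enn2real (intrinsic_dist M (x i) (x j))) (dhat i j)"
      and nonneg: "\<forall>i\<in>{1..n}. \<forall>j\<in>{1..n}. dhat i j \<ge> 0 \<and> dhat i j = dhat j i"
      and largest: "largest_width_landmarks n dhat Y l"
      and lcs: "landmark_classical_scaling n dhat l uhat" and "\<epsilon> \<le> 1 / C"
    have cover': "\<forall>p\<in>M. \<exists>i\<in>{1..n}. norm (p - x i) \<le> \<epsilon>"
      using cover \<open>n \<ge> 1\<close> by (simp add: Min_le_iff)
    then have "0 \<le> \<epsilon>"
      using x \<open>n \<ge> 1\<close> norm_ge_zero order_trans by (metis atLeastAtMost_iff order_refl)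
    have C\<epsilon>: "\<epsilon> * C \<le> 1"
      using \<open>\<epsilon> \<le> 1 / C\<close> C(1) by (simp add: pos_le_divide_eq)
    have small: "\<epsilon> \<le> 1" "\<epsilon> * (1 / \<delta>) \<le> 1" "\<epsilon> * (D / \<eta>\<^sub>0) \<le> 1" "\<epsilon> * (K * D) \<le> 1"
      using order_trans[OF mult_left_mono[OF C(1) \<open>0 \<le> \<epsilon>\<close>] C\<epsilon>]
        order_trans[OF mult_left_mono[OF C(2) \<open>0 \<le> \<epsilon>\<close>] C\<epsilon>]
        order_trans[OF mult_left_mono[OF C(3) \<open>0 \<le> \<epsilon>\<close>] C\<epsilon>]
        order_trans[OF mult_left_mono[OF C(4) \<open>0 \<le> \<epsilon>\<close>] C\<epsilon>] by simp_all
    define \<eta> where "\<eta> = D * \<epsilon>\<^sup>2"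
    have "0 \<le> \<eta>" using \<open>0 \<le> D\<close> by (simp add: \<eta>_def)
    \<comment> \<open>This lets the linear smallness conditions on \<open>\<epsilon>\<close> control
      the quadratic \<open>\<eta>\<close>.\<close>
    have "\<epsilon>\<^sup>2 \<le> \<epsilon>"
      using small(1) \<open>0 \<le> \<epsilon>\<close> mult_left_mono[of \<epsilon> 1 \<epsilon>] by (simp add: power2_eq_square)
    then have "\<eta> \<le> D * \<epsilon>" using \<open>0 \<le> D\<close> by (simp add: \<eta>_def mult_left_mono)
    then have "K * \<eta> \<le> K * (D * \<epsilon>)" using \<open>0 < K\<close> by simp
    then have "K * \<eta> \<le> 1" using small(4) by (simp add: mult_ac)
    have "\<eta> \<le> \<eta>\<^sub>0"
      using \<open>\<eta> \<le> D * \<epsilon>\<close> small(3) pos by (simp add: field_simps)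
    have "\<epsilon> \<le> \<delta>" using small(2) pos by (simp add: field_simps)
    have dhat': "\<bar>enn2real (intrinsic_dist M (x i) (x j)) - dhat i j\<bar> \<le> \<eta>"
      if "i \<in> {1..n}" "j \<in> {1..n}" for i j
    proof -
      let ?d = "enn2real (intrinsic_dist M (x i) (x j))"
      have "\<bar>?d - dhat i j\<bar> \<le> C\<^sub>0 * \<epsilon>\<^sup>2 * min ?d (dhat i j)"
        using dhat that by blast
      also have "\<dots> \<le> \<bar>C\<^sub>0\<bar> * \<epsilon>\<^sup>2 * R"
        using nonneg that x dist_le[of "x i" "x j"] by (intro mult_mono) (auto intro: min.coboundedI1)
      finally show ?thesis by (simp add: \<eta>_def D_def mult_ac)
    qed
    \<comment> \<open>A competitor only: it bounds the largest width from below.\<close>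
    obtain l' :: "'m \<Rightarrow> nat" where l': "item_tuple n l'"
      and coercive': "coercive_on_centered c (restrict_diss dhat l')"
      using landmarks[rule_format, of n x \<epsilon> \<eta> dhat] x cover' \<open>\<epsilon> \<le> \<delta>\<close> \<open>\<eta> \<le> \<eta>\<^sub>0\<close> dhat' by blast
    have scaling: "\<And>l'. item_tuple n l' \<Longrightarrow> classical_scaling (restrict_diss dhat l') (Y l')"
      and l: "item_tuple n l" and max: "width2 (Y l') \<le> width2 (Y l)"
      using largest l' by (auto simp: largest_width_landmarks_def)
    have "2 / sqrt (real CARD('m)) * sqrt c \<le> width2 (Y l')"
      by (rule classical_scaling_coerciveE[OF assms scaling[OF l'] coercive' pos(1), where 'a = real])
    then have "2 / sqrt (real CARD('m)) * sqrt c \<le> width2 (Y l)"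
      using max by linarith
    \<comment> \<open>Coercivity concerns the dissimilarities alone. It therefore passes from the
      embedding \<open>Y l\<close>, used to compare widths, to the possibly different embedding
      inside \<open>landmark_classical_scaling\<close>.\<close>
    then have coercive: "coercive_on_centered c (restrict_diss dhat l)"
      by (rule coercive_of_width2[OF assms scaling[OF l] pos(1)])
    define u where "u = (\<lambda>i. the_inv_into U \<phi> (x i))"
    have "\<forall>i\<in>{1..n}. \<forall>j\<in>{1..n}. norm (u i - u j) \<le> R \<and> \<bar>dhat i j - norm (u i - u j)\<bar> \<le> \<eta>"
      using x dist_le dhat' by (simp add: u_def flat_parametrization_dist[OF flat] abs_minus_commute)
    then obtain Q where "Q \<in> rigid_transformations"
      and Q: "\<forall>i\<in>{1..n}. norm (uhat i - Q (u i)) \<le> K * \<eta>"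
      using stable[rule_format, OF \<open>0 \<le> \<eta>\<close> \<open>K * \<eta> \<le> 1\<close> _ l coercive lcs, of u] by blast
    have "K * \<eta> \<le> C * \<epsilon>\<^sup>2"
      using mult_right_mono[OF C(4), of "\<epsilon>\<^sup>2"] by (simp add: \<eta>_def mult.assoc)
    then have "(MAX i\<in>{1..n}. norm (uhat i - Q (the_inv_into U \<phi> (x i)))) \<le> C * \<epsilon>\<^sup>2"
      using Q \<open>n \<ge> 1\<close> by (auto simp: u_def intro: order_trans)
    with \<open>Q \<in> rigid_transformations\<close> show "\<exists>Q\<in>rigid_transformations.
        (MAX i\<in>{1..n}. norm (uhat i - Q (the_inv_into U \<phi> (x i)))) \<le> C * \<epsilon>\<^sup>2" by blast
  qed
qed

end
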